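(* For all sufficiently large $d$, there exists an open set $\Omega\subset\mathbb{R}^d$ of finite measure such that: (i) $\Omega$ is connected; (ii) $\Omega$ tiles $\mathbb{R}^d$ by translations; (iii) $\Omega$ is not spectral.
   Context: A measurable set $\Omega\subset\mathbb{R}^d$ of positive, finite Lebesgue measure is called spectral if there is a set $\Lambda\subset\mathbb{R}^d$ such that the system $\{e^{2\pi i\lambda\cdot x}\}_{\lambda\in\Lambda}$ is an orthogonal basis for $L^2(\Omega)$. A measurable set $\Omega\subset\mathbb{R}^d$ of finite, positive measure tiles $\mathbb{R}^d$ by translations if there is a countable set $A\subset\mathbb{R}^d$ such that the translates $\Omega+a$, $a\in A$, cover almost every point of $\mathbb{R}^d$ exactly once. *)

theory Defs
  imports "HOL-Analysis.Analysis"
begin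

text \<open>
  The dimension \<open>d\<close> is quantified inside the theorem, so it cannot be a type. The space
  \<open>\<real>\<^sup>d\<close> is the set \<open>{..<d} \<rightarrow>\<^sub>E UNIV\<close> of functions \<open>nat \<Rightarrow> real\<close> that are \<open>undefined\<close>
  outside \<open>{..<d}\<close>; this is both \<open>topspace (Rd_top d)\<close> and \<open>space (Rd_lebesgue d)\<close>.
\<close>

abbreviation Rd :: "nat \<Rightarrow> (nat \<Rightarrow> real) set" where
  "Rd d \<equiv> {..<d} \<rightarrow>\<^sub>E UNIV"

definition Rd_top :: "nat \<Rightarrow> (nat \<Rightarrow> real) topology" where
  "Rd_top d = product_topology (\<lambda>_. euclideanreal) {..<d}"

text \<open>The completion makes the measurable sets the Lebesgue measurable ones, not just the
  Borel ones.\<close>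

definition Rd_lebesgue :: "nat \<Rightarrow> (nat \<Rightarrow> real) measure" where
  "Rd_lebesgue d = completion (PiM {..<d} (\<lambda>_. lborel))"

definition Rd_inner :: "nat \<Rightarrow> (nat \<Rightarrow> real) \<Rightarrow> (nat \<Rightarrow> real) \<Rightarrow> real" where
  "Rd_inner d x y = (\<Sum>i<d. x i * y i)"

definition Rd_translate ::
  "nat \<Rightarrow> (nat \<Rightarrow> real) set \<Rightarrow> (nat \<Rightarrow> real) \<Rightarrow> (nat \<Rightarrow> real) set" where
  "Rd_translate d \<Omega> a = (\<lambda>x. \<lambda>i\<in>{..<d}. x i + a i) ` \<Omega>"

text \<open>Elements of \<open>L\<^sup>2(\<Omega>)\<close> are represented by functions; functions equal almost everywhere
  are not identified, and values outside \<open>\<Omega>\<close> are irrelevant.\<close>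

definition L2 :: "'a measure \<Rightarrow> 'a set \<Rightarrow> ('a \<Rightarrow> complex) set" where
  "L2 M \<Omega> = {f. set_borel_measurable M \<Omega> f \<and> set_integrable M \<Omega> (\<lambda>x. (cmod (f x))\<^sup>2)}"

definition L2_inner :: "'a measure \<Rightarrow> 'a set \<Rightarrow> ('a \<Rightarrow> complex) \<Rightarrow> ('a \<Rightarrow> complex) \<Rightarrow> complex" where
  "L2_inner M \<Omega> f g = (LINT x:\<Omega>|M. f x * cnj (g x))"

definition L2_norm :: "'a measure \<Rightarrow> 'a set \<Rightarrow> ('a \<Rightarrow> complex) \<Rightarrow> real" where
  "L2_norm M \<Omega> f = sqrt (LINT x:\<Omega>|M. (cmod (f x))\<^sup>2)"

text \<open>A family of nonzero, pairwise orthogonal elements of \<open>L\<^sup>2(\<Omega>)\<close> whose finite linear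
  combinations are dense.\<close>

definition L2_orthogonal_basis ::
  "'a measure \<Rightarrow> 'a set \<Rightarrow> 'i set \<Rightarrow> ('i \<Rightarrow> 'a \<Rightarrow> complex) \<Rightarrow> bool" where
  "L2_orthogonal_basis M \<Omega> I e \<longleftrightarrow>
     (\<forall>i\<in>I. e i \<in> L2 M \<Omega> \<and> L2_norm M \<Omega> (e i) \<noteq> 0) \<and>
     (\<forall>i\<in>I. \<forall>j\<in>I. i \<noteq> j \<longrightarrow> L2_inner M \<Omega> (e i) (e j) = 0) \<and>
     (\<forall>f\<in>L2 M \<Omega>. \<forall>\<epsilon>>0. \<exists>F c. finite F \<and> F \<subseteq> I \<and>
        L2_norm M \<Omega> (\<lambda>x. f x - (\<Sum>i\<in>F. c i * e i x)) < \<epsilon>)"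

definition positive_finite_measure_set :: "nat \<Rightarrow> (nat \<Rightarrow> real) set \<Rightarrow> bool" where
  "positive_finite_measure_set d \<Omega> \<longleftrightarrow>
     \<Omega> \<in> sets (Rd_lebesgue d) \<and>
     0 < emeasure (Rd_lebesgue d) \<Omega> \<and> emeasure (Rd_lebesgue d) \<Omega> < \<infinity>"

definition spectral :: "nat \<Rightarrow> (nat \<Rightarrow> real) set \<Rightarrow> bool" where
  "spectral d \<Omega> \<longleftrightarrow> positive_finite_measure_set d \<Omega> \<and>
     (\<exists>\<Lambda>\<subseteq>Rd d. L2_orthogonal_basis (Rd_lebesgue d) \<Omega> \<Lambda>
        (\<lambda>l x. exp (2 * of_real pi * \<i> * of_real (Rd_inner d l x))))"

definition tiles_by_translations :: "nat \<Rightarrow> (nat \<Rightarrow> real) set \<Rightarrow> bool" where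
  "tiles_by_translations d \<Omega> \<longleftrightarrow> positive_finite_measure_set d \<Omega> \<and>
     (\<exists>A\<subseteq>Rd d. countable A \<and>
        (AE x in Rd_lebesgue d. \<exists>!a. a \<in> A \<and> x \<in> Rd_translate d \<Omega> a))"

end

(*
  For A = {(i, e_i) : 0 <= i < 6} in Z x Z^5 (with e_0 = 0) and an integer vector c such that
  a -> c . a is a bijection from A onto Z/6, the lattice {n : 6 | c . n} is a tiling complement
  of A. The set Omega is a union of unit cubes which, as a further coordinate n_6 varies, is made
  of layers of this form modulo 6, all tiling with the same A; hence Omega tiles. For
  c = (1, 0, ..., 0) the layer is a slab {n_0 = 0 mod 6}; for c_0 = 0 it is a union of columns
  parallel to the direction of n_0, each of which meets the adjacent slab. Alternating the two kinds
  makes Omega connected.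

  The Fourier transform of a layer at a point of (1/6)Z^6 is, up to a common phase, non-negative, and
  it is positive at multiples of c / 6. Choose for the column layers the vectors c that represent
  the 15 differences of the rows of a 6 x 6 Hadamard matrix of cube roots of unity. Then the
  transform of Omega does not vanish near any difference of the six points B in (1/3)Z^5 given by
  the rows. If Lambda were a spectrum, the points of Lambda near a translate of (1/3)Z^5 / Z^5
  would form a set S for which S + B is direct in (Z/3)^5, so that card S <= 3^5 / 6 < 40.5
  and card S <= 40. But Lambda has density |Omega|, which forces an average of 40.5.
*)
theory Submission
  imports Defs
begin

section \<open>Finite orthogonal systems\<close>

text \<open>Why Hadamard rows: tiling with A forces the transform of the periodic layers to vanish,
  off the integer frequencies, wherever that of A does not. At the difference of two distinct rows
  the transform of A is the sum of six cube roots of unity, each occurring twice, hence zero, so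
  there the layers are free to be non-zero. As 6 does not divide 3^5, the bound 3^5 / 6 is not an
  integer; this gap is the whole contradiction. The obstacle is finite measure. The periodic pattern
  has to be cut to a box of side m = 30 N, and then its transform is under control only within 1 / m
  of the chosen frequencies. Nothing is lost: 3^5 cells of side 1 / m have measure 3^5 / m^d, while
  Omega has measure at least m^d / 6, so the product is at least 40.5 for every m. N only has to be
  so large that the transform of a single period of side 30 stays away from 0 on these
  cells.\<close>

lemma orthogonal_expansion:
  fixes f :: "'a \<Rightarrow> complex" and e :: "'i \<Rightarrow> 'a \<Rightarrow> complex"
  assumes F: "finite F"
    and ff: "integrable M (\<lambda>x. f x * cnj (f x))"
    and fe: "\<And>i. i \<in> F \<Longrightarrow> integrable M (\<lambda>x. f x * cnj (e i x))"
    and ee: "\<And>i j. i \<in> F \<Longrightarrow> j \<in> F \<Longrightarrow> integrable M (\<lambda>x. e i x * cnj (e j x))"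
    and orth: "\<And>i j. i \<in> F \<Longrightarrow> j \<in> F \<Longrightarrow>
      (\<integral>x. e i x * cnj (e j x) \<partial>M) = (if i = j then of_real V else 0)"
  shows "(\<integral>x. (cmod (f x - (\<Sum>i\<in>F. c i * e i x)))\<^sup>2 \<partial>M) =
    (\<integral>x. (cmod (f x))\<^sup>2 \<partial>M) +
    (\<Sum>i\<in>F. V * (cmod (c i))\<^sup>2 - 2 * Re (cnj (c i) * (\<integral>x. f x * cnj (e i x) \<partial>M)))"
proof -
  define a where "a i = (\<integral>x. f x * cnj (e i x) \<partial>M)" for i
  have sq: "complex_of_real ((cmod z)\<^sup>2) = z * cnj z" for z
    by (rule complex_norm_square)
  have ef: "integrable M (\<lambda>x. e i x * cnj (f x))" if "i \<in> F" for i
    using integrable_cnj[OF fe[OF that]] by (simp add: mult.commute)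
  have efv: "(\<integral>x. e i x * cnj (f x) \<partial>M) = cnj (a i)" for i
    using Bochner_Integration.integral_cnj[of M "\<lambda>x. f x * cnj (e i x)"] by (simp add: a_def mult.commute)
  have expand: "(f x - (\<Sum>i\<in>F. c i * e i x)) * cnj (f x - (\<Sum>i\<in>F. c i * e i x)) =
     f x * cnj (f x) - (\<Sum>i\<in>F. cnj (c i) * (f x * cnj (e i x))) -
     (\<Sum>i\<in>F. c i * (e i x * cnj (f x))) +
     (\<Sum>i\<in>F. \<Sum>j\<in>F. c i * cnj (c j) * (e i x * cnj (e j x)))" for x
    by (simp add: algebra_simps sum_distrib_left sum_distrib_right sum_product) (rule sum.swap)
  have "complex_of_real (\<integral>x. (cmod (f x - (\<Sum>i\<in>F. c i * e i x)))\<^sup>2 \<partial>M) =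
     (\<integral>x. f x * cnj (f x) - (\<Sum>i\<in>F. cnj (c i) * (f x * cnj (e i x))) -
     (\<Sum>i\<in>F. c i * (e i x * cnj (f x))) +
     (\<Sum>i\<in>F. \<Sum>j\<in>F. c i * cnj (c j) * (e i x * cnj (e j x))) \<partial>M)"
    unfolding integral_complex_of_real[symmetric] sq expand ..
  also have "\<dots> = (\<integral>x. f x * cnj (f x) \<partial>M) - (\<Sum>i\<in>F. cnj (c i) * a i) -
     (\<Sum>i\<in>F. c i * cnj (a i)) +
     (\<Sum>i\<in>F. \<Sum>j\<in>F. c i * cnj (c j) * (if i = j then of_real V else 0))"
    using ff fe ef ee
    by (simp add: Bochner_Integration.integral_sum Bochner_Integration.integral_add
        Bochner_Integration.integral_diff efv orth flip: a_def cong: sum.cong)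
  also have "\<dots> = (\<integral>x. f x * cnj (f x) \<partial>M) - (\<Sum>i\<in>F. cnj (c i) * a i) -
     (\<Sum>i\<in>F. c i * cnj (a i)) + (\<Sum>i\<in>F. of_real V * of_real ((cmod (c i))\<^sup>2))"
  proof -
    have "(\<Sum>j\<in>F. c i * cnj (c j) * (if i = j then of_real V else 0)) =
        of_real V * of_real ((cmod (c i))\<^sup>2)" if "i \<in> F" for i
      using that F unfolding sq by (simp add: if_distrib[where f="\<lambda>x. _ * x"] mult_ac cong: if_cong)
    thus ?thesis by (simp cong: sum.cong)
  qed
  also have "\<dots> = complex_of_real (\<integral>x. (cmod (f x))\<^sup>2 \<partial>M) +
     (\<Sum>i\<in>F. of_real (V * (cmod (c i))\<^sup>2 - 2 * Re (cnj (c i) * a i)))"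
  proof -
    have *: "z + cnj z = of_real (2 * Re z)" for z by (simp add: complex_add_cnj)
    have "cnj (c i) * a i + c i * cnj (a i) = of_real (2 * Re (cnj (c i) * a i))" for i
      using *[of "cnj (c i) * a i"] by simp
    hence "(\<Sum>i\<in>F. cnj (c i) * a i) + (\<Sum>i\<in>F. c i * cnj (a i)) =
      (\<Sum>i\<in>F. of_real (2 * Re (cnj (c i) * a i)))"
      by (simp only: sum.distrib[symmetric])
    moreover have "(\<integral>x. f x * cnj (f x) \<partial>M) = complex_of_real (\<integral>x. (cmod (f x))\<^sup>2 \<partial>M)"
      unfolding integral_complex_of_real[symmetric] sq ..
    ultimately show ?thesis
      by (simp only: of_real_diff of_real_mult[of V] sum_subtractf) (simp only: algebra_simps)
  qed
  also have "\<dots> = complex_of_real ((\<integral>x. (cmod (f x))\<^sup>2 \<partial>M) +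
    (\<Sum>i\<in>F. V * (cmod (c i))\<^sup>2 - 2 * Re (cnj (c i) * a i)))"
    by simp
  finally show ?thesis unfolding of_real_eq_iff a_def .
qed

text \<open>Each term V |c|^2 - 2 Re (cnj c * a) is at least -|a|^2 / V, by completing the square.
  For a spectrum this turns approximability in the mean into a lower bound for a finite sum of
  squared coefficients.\<close>

lemma best_approximation:
  fixes f :: "'a \<Rightarrow> complex" and e :: "'i \<Rightarrow> 'a \<Rightarrow> complex"
  assumes F: "finite F" and V: "V > 0"
    and ff: "integrable M (\<lambda>x. f x * cnj (f x))"
    and fe: "\<And>i. i \<in> F \<Longrightarrow> integrable M (\<lambda>x. f x * cnj (e i x))"
    and ee: "\<And>i j. i \<in> F \<Longrightarrow> j \<in> F \<Longrightarrow> integrable M (\<lambda>x. e i x * cnj (e j x))"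
    and orth: "\<And>i j. i \<in> F \<Longrightarrow> j \<in> F \<Longrightarrow>
      (\<integral>x. e i x * cnj (e j x) \<partial>M) = (if i = j then of_real V else 0)"
  shows "(\<integral>x. (cmod (f x))\<^sup>2 \<partial>M) - (\<Sum>i\<in>F. (cmod (\<integral>x. f x * cnj (e i x) \<partial>M))\<^sup>2) / V
    \<le> (\<integral>x. (cmod (f x - (\<Sum>i\<in>F. c i * e i x)))\<^sup>2 \<partial>M)"
proof -
  define a where "a i = (\<integral>x. f x * cnj (e i x) \<partial>M)" for i
  have "- ((cmod (a i))\<^sup>2 / V) \<le> V * (cmod (c i))\<^sup>2 - 2 * Re (cnj (c i) * a i)" for i
  proof -
    have "Re (cnj (c i) * a i) \<le> cmod (c i) * cmod (a i)"
      by (metis complex_Re_le_cmod complex_mod_cnj norm_mult)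
    moreover have "0 \<le> (V * cmod (c i) - cmod (a i))\<^sup>2 / V" using V by simp
    hence "0 \<le> V * (cmod (c i))\<^sup>2 + (cmod (a i))\<^sup>2 / V - 2 * (cmod (c i) * cmod (a i))"
      using V by (simp add: power2_eq_square field_simps)
    ultimately show ?thesis by linarith
  qed
  hence "(\<Sum>i\<in>F. - ((cmod (a i))\<^sup>2 / V)) \<le> (\<Sum>i\<in>F. V * (cmod (c i))\<^sup>2 - 2 * Re (cnj (c i) * a i))"
    by (rule sum_mono)
  moreover have "(\<integral>x. (cmod (f x - (\<Sum>i\<in>F. c i * e i x)))\<^sup>2 \<partial>M) =
    (\<integral>x. (cmod (f x))\<^sup>2 \<partial>M) + (\<Sum>i\<in>F. V * (cmod (c i))\<^sup>2 - 2 * Re (cnj (c i) * a i))"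
    unfolding a_def by (rule orthogonal_expansion[OF F ff fe ee orth])
  ultimately show ?thesis
    by (simp only: sum_negf sum_divide_distrib a_def[symmetric])
qed

text \<open>The optimal coefficients c = a / V, put into the expansion of a non-negative integral.
  It is applied to the exponentials of a full box, whereas the preceding bound is applied to those
  of a spectrum.\<close>

lemma Bessel_inequality:
  fixes f :: "'a \<Rightarrow> complex" and e :: "'i \<Rightarrow> 'a \<Rightarrow> complex"
  assumes F: "finite F" and V: "V > 0"
    and ff: "integrable M (\<lambda>x. f x * cnj (f x))"
    and fe: "\<And>i. i \<in> F \<Longrightarrow> integrable M (\<lambda>x. f x * cnj (e i x))"
    and ee: "\<And>i j. i \<in> F \<Longrightarrow> j \<in> F \<Longrightarrow> integrable M (\<lambda>x. e i x * cnj (e j x))"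
    and orth: "\<And>i j. i \<in> F \<Longrightarrow> j \<in> F \<Longrightarrow>
      (\<integral>x. e i x * cnj (e j x) \<partial>M) = (if i = j then of_real V else 0)"
  shows "(\<Sum>i\<in>F. (cmod (\<integral>x. f x * cnj (e i x) \<partial>M))\<^sup>2) \<le> V * (\<integral>x. (cmod (f x))\<^sup>2 \<partial>M)"
proof -
  define a where "a i = (\<integral>x. f x * cnj (e i x) \<partial>M)" for i
  have *: "V * (cmod (a i / V))\<^sup>2 - 2 * Re (cnj (a i / V) * a i) = - ((cmod (a i))\<^sup>2 / V)" for i
  proof -
    have "cnj (a i / V) * a i = of_real ((cmod (a i))\<^sup>2 / V)"
      by (simp add: complex_norm_square mult.commute del: of_real_power)
    thus ?thesis using V by (simp add: norm_divide power2_eq_square)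
  qed
  have "0 \<le> (\<integral>x. (cmod (f x - (\<Sum>i\<in>F. a i / V * e i x)))\<^sup>2 \<partial>M)" by simp
  also have "\<dots> = (\<integral>x. (cmod (f x))\<^sup>2 \<partial>M) - (\<Sum>i\<in>F. (cmod (a i))\<^sup>2) / V"
    using orthogonal_expansion[OF F ff fe ee orth, where c = "\<lambda>i. a i / V"]
    by (simp only: a_def[symmetric] * sum_negf sum_divide_distrib)
  finally show ?thesis using V by (simp add: field_simps flip: a_def)
qed

section \<open>The characters of the real line\<close>

definition ex :: "real \<Rightarrow> complex" where "ex t = cis (2 * pi * t)"

lemma ex_0 [simp]: "ex 0 = 1" by (simp add: ex_def)
lemma ex_add: "ex (s + t) = ex s * ex t" by (simp add: ex_def cis_mult algebra_simps)
lemma ex_minus: "ex (- t) = cnj (ex t)" by (simp add: ex_def cis_cnj)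
lemma ex_diff: "ex (s - t) = ex s * cnj (ex t)" using ex_add[of s "- t"] by (simp add: ex_minus)
lemma norm_ex [simp]: "cmod (ex t) = 1" by (simp add: ex_def)
lemma ex_of_nat_mult: "ex (of_nat n * t) = ex t ^ n"
  unfolding ex_def Complex.DeMoivre by (rule arg_cong[where f = cis]) simp
lemma ex_eq_1_iff: "ex t = 1 \<longleftrightarrow> t \<in> \<int>"
proof
  assume "ex t = 1"
  hence "cos (2 * pi * t) = 1" by (metis ex_def Re_complex_of_real cis.simps(1) of_real_1 )
  then obtain k :: int where "2 * pi * t = of_int k * (2 * pi)"
    using cos_one_2pi_int by auto
  hence "t = of_int k" by simp
  thus "t \<in> \<int>" by simp
next
  assume "t \<in> \<int>"
  thus "ex t = 1" by (auto elim!: Ints_cases simp: ex_def cis_multiple_2pi)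
qed
lemma ex_sum: "finite A \<Longrightarrow> ex (\<Sum>k\<in>A. f k) = (\<Prod>k\<in>A. ex (f k))"
  by (induction A rule: finite_induct) (auto simp: ex_add)
lemma continuous_ex [continuous_intros]:
  "continuous_on S f \<Longrightarrow> continuous_on S (\<lambda>x. ex (f x))"
  unfolding ex_def by (intro continuous_intros)
lemma measurable_ex [measurable]: "ex \<in> borel_measurable borel"
  by (intro borel_measurable_continuous_onI continuous_intros)
lemma ex_exp: "exp (2 * of_real pi * \<i> * of_real t) = ex t"
  by (simp add: ex_def cis_conv_exp mult_ac)
lemma norm_ex_minus_1: "cmod (ex t - 1) \<le> 2 * pi * \<bar>t\<bar>"
  using dist_exp_i_1[of "2*pi*t"] abs_sin_x_le_abs_x[of "pi * t"]
  by (simp add: ex_def cis_conv_exp abs_mult mult_ac)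

text \<open>Fourier transform of the interval \<open>[0, 1)\<close>.\<close>
definition unit_ft :: "real \<Rightarrow> complex" where
  "unit_ft t = (if t = 0 then 1 else (ex t - 1) / (2 * of_real pi * \<i> * of_real t))"

lemma unit_ft_0 [simp]: "unit_ft 0 = 1" by (simp add: unit_ft_def)

text \<open>The zeros of this transform are the non-zero integers. For this reason the frequency
  differences are represented inside (-1, 1) later on.\<close>

lemma unit_ft_nonzero: "\<bar>t\<bar> < 1 \<Longrightarrow> unit_ft t \<noteq> 0"
proof -
  assume t: "\<bar>t\<bar> < 1"
  have "ex t \<noteq> 1" if "t \<noteq> 0"
    unfolding ex_eq_1_iff using that t by (auto elim!: Ints_cases)
  thus ?thesis by (auto simp: unit_ft_def)
qed

lemma integrable_ex_Ico: "integrable lborel (\<lambda>x. indicator {a..<b} x * ex (t * x))"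
proof (rule Bochner_Integration.integrable_bound[of lborel "indicator {a..<b} :: real \<Rightarrow> real"])
  show "integrable lborel (indicat_real {a..<b})"
    by (rule integrable_real_indicator) (use emeasure_bounded_finite[of "{a..<b}"] in auto)
qed (auto simp: norm_mult indicator_def)

lemma ex_has_vector_derivative:
  "((\<lambda>x. ex (t * x)) has_vector_derivative 2 * of_real pi * \<i> * of_real t * ex (t * x)) (at x within S)"
proof -
  have "((\<lambda>x. exp (2 * of_real pi * \<i> * of_real t * x)) has_field_derivative
      2 * of_real pi * \<i> * of_real t * exp (2 * of_real pi * \<i> * of_real t * of_real x)) (at (of_real x))"
    by (auto intro!: derivative_eq_intros)
  from has_vector_derivative_real_field[OF this, of S] show ?thesis
    unfolding ex_exp[symmetric] by (simp add: mult_ac)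
qed

lemma integral_ex_Ico:
  assumes "a \<le> b" "t \<noteq> 0"
  shows "(\<integral>x. indicator {a..<b} x * ex (t * x) \<partial>lborel) =
    (ex (t * b) - ex (t * a)) / (2 * of_real pi * \<i> * of_real t)"
proof -
  let ?c = "2 * of_real pi * \<i> * complex_of_real t"
  have "(\<integral>x. indicator {a..<b} x * ex (t * x) \<partial>lborel) = (\<integral>x. indicator {a..b} x *\<^sub>R ex (t * x) \<partial>lborel)"
  proof (rule integral_cong_AE)
    have "AE x in lborel. x \<noteq> b" by (rule AE_lborel_singleton)
    thus "AE x in lborel. indicator {a..<b} x * ex (t * x) = indicator {a..b} x *\<^sub>R ex (t * x)"
      by eventually_elim (auto simp: indicator_def)
  qed auto
  also have "\<dots> = ex (t * b) / ?c - ex (t * a) / ?c"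
  proof (rule integral_FTC_Icc[OF \<open>a \<le> b\<close>])
    fix x
    have "((\<lambda>x. ex (t * x) / ?c) has_vector_derivative ?c * ex (t * x) / ?c) (at x within {a..b})"
      by (intro has_vector_derivative_divide ex_has_vector_derivative)
    thus "((\<lambda>x. ex (t * x) / ?c) has_vector_derivative ex (t * x)) (at x within {a..b})"
      using assms by simp
  qed (intro continuous_intros)
  finally show ?thesis by (simp add: diff_divide_distrib)
qed

lemma integral_ex_unit:
  "(\<integral>x. indicator {of_int n..<of_int n + 1} x * ex (t * x) \<partial>lborel) = ex (t * of_int n) * unit_ft t"
proof (cases "t = 0")
  case True
  have "(\<integral>x. complex_of_real (indicator {of_int n..<of_int n + 1 :: real} x) \<partial>lborel) = 1"
    by (subst integral_complex_of_real) (simp add: measure_def)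
  thus ?thesis using True by (simp add: of_real_indicator)
next
  case False
  thus ?thesis unfolding unit_ft_def
    by (subst integral_ex_Ico) (auto simp: ex_add algebra_simps)
qed

lemma integral_ex_period:
  assumes "M > 0"
  shows "(\<integral>x. indicator {0..<M} x * ex (of_int z / M * x) \<partial>lborel) = (if z = 0 then of_real M else 0)"
proof (cases "z = 0")
  case True
  have "(\<integral>x. complex_of_real (indicator {0..<M} x) \<partial>lborel) = of_real M"
    using assms by (subst integral_complex_of_real) simp
  thus ?thesis using True by (simp add: of_real_indicator)
next
  case False
  have "ex (of_int z) = 1" by (simp add: ex_eq_1_iff)
  thus ?thesis using assms False by (subst integral_ex_Ico) auto
qed

section \<open>Lebesgue measure on \<open>\<real>\<^sup>d\<close>\<close>

abbreviation Rd_borel :: "nat \<Rightarrow> (nat \<Rightarrow> real) measure" where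
  "Rd_borel d \<equiv> PiM {..<d} (\<lambda>_. lborel)"

interpretation lborel_product: product_sigma_finite "\<lambda>_::nat. lborel :: real measure"
  by unfold_locales

lemma sigma_finite_Rd_borel: "sigma_finite_measure (Rd_borel d)"
  by (rule lborel_product.sigma_finite) simp

lemma space_Rd_borel: "space (Rd_borel d) = Rd d"
  by (simp add: space_PiM)

definition shift :: "nat \<Rightarrow> (nat \<Rightarrow> real) \<Rightarrow> (nat \<Rightarrow> real) \<Rightarrow> nat \<Rightarrow> real" where
  "shift d a x = (\<lambda>k\<in>{..<d}. x k + a k)"

lemma shift_in_Rd [simp]: "shift d a x \<in> Rd d" by (simp add: shift_def)
lemma shift_apply [simp]: "k < d \<Longrightarrow> shift d a x k = x k + a k" by (simp add: shift_def)

lemma Rd_eqI: "x \<in> Rd d \<Longrightarrow> y \<in> Rd d \<Longrightarrow> (\<And>k. k < d \<Longrightarrow> x k = y k) \<Longrightarrow> x = y"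
  by (auto intro: PiE_ext)

lemma measurable_shift [measurable]: "shift d a \<in> measurable (Rd_borel d) (Rd_borel d)"
  unfolding shift_def by (rule measurable_restrict) simp

text \<open>A product measure is determined by its values on boxes, where the claim reduces to
  translation invariance in each coordinate.\<close>

lemma distr_shift: "distr (Rd_borel d) (Rd_borel d) (shift d a) = Rd_borel d"
proof (rule lborel_product.PiM_eqI)
  fix A :: "nat \<Rightarrow> real set" assume A: "\<And>i. i \<in> {..<d} \<Longrightarrow> A i \<in> sets lborel"
  have vim: "(\<lambda>x. x + a i) -` A i \<in> sets lborel" if "i < d" for i
    using A[of i] that measurable_sets_borel[of "\<lambda>x. x + a i" borel "A i"] by simp
  have em: "emeasure lborel ((\<lambda>x. x + a i) -` A i) = emeasure lborel (A i)" if "i < d" for i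
  proof -
    have "emeasure lborel (A i) = emeasure (distr lborel borel ((+) (a i))) (A i)"
      by (simp add: lborel_distr_plus)
    also have "\<dots> = emeasure lborel ((+) (a i) -` A i \<inter> space lborel)"
      using A[of i] that by (intro emeasure_distr) auto
    finally show ?thesis by (simp add: add.commute[of _ "a i"])
  qed
  have "emeasure (distr (Rd_borel d) (Rd_borel d) (shift d a)) (PiE {..<d} A) =
      emeasure (Rd_borel d) (shift d a -` PiE {..<d} A \<inter> space (Rd_borel d))"
    using A by (intro emeasure_distr measurable_shift sets_PiM_I_finite) auto
  also have "shift d a -` PiE {..<d} A \<inter> space (Rd_borel d) = (\<Pi>\<^sub>E i\<in>{..<d}. (\<lambda>x. x + a i) -` A i)"
    by (auto simp: space_PiM shift_def PiE_iff)
  also have "emeasure (Rd_borel d) \<dots> = (\<Prod>i\<in>{..<d}. emeasure lborel (A i))"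
    using vim em by (subst lborel_product.emeasure_PiM) auto
  finally show "emeasure (distr (Rd_borel d) (Rd_borel d) (shift d a)) (PiE {..<d} A) =
      (\<Prod>i\<in>{..<d}. emeasure lborel (A i))" .
qed auto

lemma nn_integral_shift:
  assumes "f \<in> borel_measurable (Rd_borel d)"
  shows "(\<integral>\<^sup>+x. f (shift d a x) \<partial>Rd_borel d) = (\<integral>\<^sup>+x. f x \<partial>Rd_borel d)"
  using nn_integral_distr[OF measurable_shift[of d a], of f] assms by (simp add: distr_shift)

text \<open>The exceptional points lie on countably many hyperplanes, each a box with one side a
  single point. This makes the faces of unit cubes negligible.\<close>

lemma AE_coordinates_not_Ints: "AE x in Rd_borel d. \<forall>k<d. x k \<notin> \<int>"
proof -
  have "AE x in Rd_borel d. x k \<noteq> of_int m" if "k < d" for k and m :: int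
  proof -
    let ?N = "\<Pi>\<^sub>E i\<in>{..<d}. if i = k then {of_int m :: real} else UNIV"
    have "emeasure (Rd_borel d) ?N = (\<Prod>i\<in>{..<d}. emeasure lborel (if i = k then {of_int m :: real} else UNIV))"
      by (rule lborel_product.emeasure_PiM) auto
    also have "\<dots> = 0" using that by (intro prod_zero) auto
    finally have "?N \<in> null_sets (Rd_borel d)"
      by (intro null_setsI sets_PiM_I_finite) auto
    moreover have "{x \<in> space (Rd_borel d). \<not> x k \<noteq> of_int m} \<subseteq> ?N"
      using PiE_arb by (fastforce simp: space_PiM PiE_iff extensional_def)
    ultimately show ?thesis by (rule AE_I')
  qed
  hence "AE x in Rd_borel d. \<forall>k\<in>{..<d}. \<forall>m::int. x k \<noteq> of_int m"
    by (subst AE_ball_countable) (auto simp: AE_all_countable)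
  thus ?thesis by eventually_elim (auto elim!: Ints_cases)
qed

lemma Rd_inner_measurable [measurable]:
  "Rd_inner d l \<in> borel_measurable (Rd_borel d)"
  unfolding Rd_inner_def by measurable

lemma ex_Rd_inner: "ex (Rd_inner d l x) = (\<Prod>k<d. ex (l k * x k))"
  by (simp add: Rd_inner_def ex_sum)

lemma box_in_sets: "(\<And>k. k < d \<Longrightarrow> A k \<in> sets borel) \<Longrightarrow> PiE {..<d} A \<in> sets (Rd_borel d)"
  by (intro sets_PiM_I_finite) auto

lemma indicator_PiE:
  "x \<in> Rd d \<Longrightarrow> (indicator (PiE {..<d} A) x :: 'a :: {comm_semiring_1}) = (\<Prod>k<d. indicator (A k) (x k))"
  by (cases "x \<in> PiE {..<d} A") (auto simp: indicator_def PiE_iff prod_zero_iff intro!: prod_zero)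

lemma integral_ex_box:
  assumes "\<And>k. k < d \<Longrightarrow> a k \<le> b k"
  shows "(\<integral>x. indicator (\<Pi>\<^sub>E k\<in>{..<d}. {a k..<b k}) x * ex (Rd_inner d l x) \<partial>Rd_borel d) =
    (\<Prod>k<d. \<integral>x. indicator {a k..<b k} x * ex (l k * x) \<partial>lborel)" (is ?A)
   and "integrable (Rd_borel d) (\<lambda>x. indicator (\<Pi>\<^sub>E k\<in>{..<d}. {a k..<b k}) x * ex (Rd_inner d l x))" (is ?B)
proof -
  have eq: "indicator (\<Pi>\<^sub>E k\<in>{..<d}. {a k..<b k}) x * ex (Rd_inner d l x) =
     (\<Prod>k<d. indicator {a k..<b k} (x k) * ex (l k * x k))" if "x \<in> space (Rd_borel d)" for x
    using that by (simp add: ex_Rd_inner prod.distrib space_PiM indicator_PiE)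
  show ?A
    by (subst Bochner_Integration.integral_cong[OF refl eq])
       (auto intro!: lborel_product.product_integral_prod integrable_ex_Ico)
  show ?B
    by (subst Bochner_Integration.integrable_cong[OF refl eq])
       (auto intro!: lborel_product.product_integrable_prod integrable_ex_Ico)
qed

section \<open>A criterion for a set not to be spectral\<close>

text \<open>The exponent has a positive sign, so that the inner product of the exponentials of l and
  l' over the set is the value at l - l'. The Borel product measure is used here;
  \<open>spectral_imp\<close> does the passage from its completion.\<close>

definition ft :: "nat \<Rightarrow> (nat \<Rightarrow> real) set \<Rightarrow> (nat \<Rightarrow> real) \<Rightarrow> complex" where
  "ft d \<Omega> \<xi> = (\<integral>x. indicator \<Omega> x * ex (Rd_inner d \<xi> x) \<partial>Rd_borel d)"

lemma Rd_inner_cong: "(\<And>k. k < d \<Longrightarrow> l k = l' k) \<Longrightarrow> Rd_inner d l x = Rd_inner d l' x"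
  by (simp add: Rd_inner_def)

lemma ft_cong: "(\<And>k. k < d \<Longrightarrow> l k = l' k) \<Longrightarrow> ft d \<Omega> l = ft d \<Omega> l'"
  unfolding ft_def using Rd_inner_cong[of d l l'] by simp

lemma Rd_inner_diff: "Rd_inner d (\<lambda>k. l k - l' k) x = Rd_inner d l x - Rd_inner d l' x"
  by (simp add: Rd_inner_def left_diff_distrib sum_subtractf)

lemma nn_integral_count_space_le:
  fixes f :: "'a \<Rightarrow> ennreal"
  assumes A: "countable A" and le: "\<And>F. finite F \<Longrightarrow> F \<subseteq> A \<Longrightarrow> sum f F \<le> c"
  shows "(\<integral>\<^sup>+x. f x \<partial>count_space A) \<le> c"
proof (cases "finite A")
  case True
  thus ?thesis using le[of A] by (simp add: nn_integral_count_space_finite)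
next
  case False
  define g where "g = from_nat_into A"
  have g: "bij_betw g UNIV A" unfolding g_def by (rule bij_betw_from_nat_into[OF A False])
  have "(\<integral>\<^sup>+x. f x \<partial>count_space A) = (\<integral>\<^sup>+n. f (g n) \<partial>count_space UNIV)"
    by (rule nn_integral_bij_count_space[OF g, symmetric])
  also have "\<dots> = (\<Sum>n. f (g n))" by (rule nn_integral_count_space_nat)
  also have "\<dots> \<le> c"
  proof (rule suminf_le_const)
    fix n
    have "(\<Sum>i<n. f (g i)) = sum f (g ` {..<n})"
      using g by (subst sum.reindex) (auto simp: bij_betw_def intro: inj_on_subset)
    also have "\<dots> \<le> c" using g by (intro le) (auto simp: bij_betw_def)
    finally show "(\<Sum>i<n. f (g i)) \<le> c" .
  qed simp
  finally show ?thesis .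
qed

lemma shift_uminus_shift: "x \<in> Rd d \<Longrightarrow> shift d (\<lambda>k. - a k) (shift d a x) = x"
  by (rule Rd_eqI[OF shift_in_Rd]) simp_all

lemma measurable_indicator_shift:
  assumes "W \<in> sets (Rd_borel d)"
  shows "(\<lambda>x. indicator W (shift d a x) :: ennreal) \<in> borel_measurable (Rd_borel d)"
  by (rule measurable_compose[OF measurable_shift borel_measurable_indicator[OF assms]])

text \<open>\<open>Box\<close> and \<open>cell\<close>, of sides M and 1 / M, are dual: exponentials
  with frequencies in a translate of (1/M) Z^d are orthogonal on \<open>Box\<close>, and the
  translates of \<open>cell\<close> by (1/M) Z^d partition the space of frequencies.\<close>

locale bounded_set =
  fixes d :: nat and M :: real and \<Omega> :: "(nat \<Rightarrow> real) set"
  assumes M_pos: "M > 0"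
    and \<Omega>_sets [measurable]: "\<Omega> \<in> sets (Rd_borel d)"
    and \<Omega>_sub: "\<Omega> \<subseteq> (\<Pi>\<^sub>E k\<in>{..<d}. {0..<M})"
begin

abbreviation "Box \<equiv> (\<Pi>\<^sub>E k\<in>{..<d}. {0..<M})"
abbreviation "cell \<equiv> (\<Pi>\<^sub>E k\<in>{..<d}. {0..<1 / M})"

abbreviation "V \<equiv> measure (Rd_borel d) \<Omega>"

lemma box_sets [measurable]: "Box \<in> sets (Rd_borel d)" and cell_sets [measurable]: "cell \<in> sets (Rd_borel d)"
  by (auto intro: box_in_sets)

lemma emeasure_finite: "emeasure (Rd_borel d) \<Omega> < \<infinity>"
proof -
  have "emeasure (Rd_borel d) \<Omega> \<le> emeasure (Rd_borel d) Box"
    by (intro emeasure_mono \<Omega>_sub) measurable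
  also have "\<dots> = (\<Prod>k<d. emeasure lborel {0..<M})"
    by (rule lborel_product.emeasure_PiM) auto
  also have "\<dots> < \<infinity>"
    using M_pos by (simp add: ennreal_power)
  finally show ?thesis .
qed

lemma integrable_bounded:
  fixes g :: "(nat \<Rightarrow> real) \<Rightarrow> 'b :: {real_normed_algebra_1, banach, second_countable_topology}"
  assumes [measurable]: "g \<in> borel_measurable (Rd_borel d)" and "\<And>x. norm (g x) \<le> B"
  shows "integrable (Rd_borel d) (\<lambda>x. indicator \<Omega> x * g x)"
proof (rule Bochner_Integration.integrable_bound)
  show "integrable (Rd_borel d) (\<lambda>x. indicat_real \<Omega> x * B)"
    using emeasure_finite by (intro integrable_mult_left integrable_real_indicator) auto
  have "0 \<le> B" using assms(2)[of undefined] norm_ge_zero order_trans by blast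
  thus "AE x in Rd_borel d. norm (indicator \<Omega> x * g x) \<le> norm (indicat_real \<Omega> x * B)"
    using assms(2) by (auto simp: indicator_def intro!: AE_I2)
qed measurable

lemma integral_indicator: "(\<integral>x. indicator \<Omega> x \<partial>Rd_borel d) = (of_real V :: complex)"
proof -
  have "(\<integral>x. complex_of_real (indicator \<Omega> x) \<partial>Rd_borel d) = of_real (\<integral>x. indicator \<Omega> x \<partial>Rd_borel d)"
    by (rule integral_complex_of_real)
  also have "(\<integral>x. indicator \<Omega> x \<partial>Rd_borel d) = V"
    using sets.sets_into_space[OF \<Omega>_sets] by (simp add: Int_absorb1 Int_absorb2)
  finally show ?thesis by (simp add: of_real_indicator)
qed

lemma ft_0: "(\<And>k. k < d \<Longrightarrow> \<xi> k = 0) \<Longrightarrow> ft d \<Omega> \<xi> = of_real V"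
  by (simp add: ft_def Rd_inner_def integral_indicator)

lemma ft_measurable [measurable]: "ft d \<Omega> \<in> borel_measurable (Rd_borel d)"
proof -
  interpret sigma_finite_measure "Rd_borel d" by (rule sigma_finite_Rd_borel)
  have comp: "(\<lambda>p. fst p k) \<in> borel_measurable (Rd_borel d \<Otimes>\<^sub>M Rd_borel d)"
    "(\<lambda>p. snd p k) \<in> borel_measurable (Rd_borel d \<Otimes>\<^sub>M Rd_borel d)" if "k < d" for k
    using that by (auto intro!: measurable_compose[OF measurable_fst measurable_component_singleton]
        measurable_compose[OF measurable_snd measurable_component_singleton] simp flip: measurable_lborel2)
  have [measurable]: "(\<lambda>p. Rd_inner d (fst p) (snd p)) \<in> borel_measurable (Rd_borel d \<Otimes>\<^sub>M Rd_borel d)"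
    unfolding Rd_inner_def by (intro borel_measurable_sum borel_measurable_times comp) auto
  have "(\<lambda>p. indicator \<Omega> (snd p) * ex (Rd_inner d (fst p) (snd p))) \<in> borel_measurable (Rd_borel d \<Otimes>\<^sub>M Rd_borel d)"
    by measurable
  thus ?thesis unfolding ft_def[abs_def]
    by (intro borel_measurable_lebesgue_integral) (simp add: case_prod_beta')
qed

lemma ft_diff:
  "(\<integral>x. (indicator \<Omega> x * ex (Rd_inner d l x)) * cnj (indicator \<Omega> x * ex (Rd_inner d l' x)) \<partial>Rd_borel d)
    = ft d \<Omega> (\<lambda>k. l k - l' k)"
  unfolding ft_def Rd_inner_diff ex_diff
  by (intro Bochner_Integration.integral_cong) (auto simp: indicator_def)

lemma integrable_products:
  "integrable (Rd_borel d) (\<lambda>x. (indicator \<Omega> x * ex (Rd_inner d l x)) * cnj (indicator \<Omega> x * ex (Rd_inner d l' x)))"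
proof -
  have "integrable (Rd_borel d) (\<lambda>x. indicator \<Omega> x * (ex (Rd_inner d l x) * cnj (ex (Rd_inner d l' x))))"
    unfolding ex_minus[symmetric] by (rule integrable_bounded[where B = 1]) (auto simp: norm_mult)
  thus ?thesis
    by (rule Bochner_Integration.integrable_cong[THEN iffD1, rotated -1]) (auto simp: indicator_def)
qed

lemma integral_norm_sq:
  "(\<integral>x. (cmod (indicator \<Omega> x * ex (Rd_inner d l x)))\<^sup>2 \<partial>Rd_borel d) = V"
proof -
  have "(\<integral>x. (cmod (indicator \<Omega> x * ex (Rd_inner d l x)))\<^sup>2 \<partial>Rd_borel d) = (\<integral>x. indicator \<Omega> x \<partial>Rd_borel d)"
    by (intro Bochner_Integration.integral_cong) (auto simp: indicator_def norm_mult)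
  also have "\<dots> = V" using sets.sets_into_space[OF \<Omega>_sets] by (simp add: Int_absorb1 Int_absorb2)
  finally show ?thesis .
qed

text \<open>On \<open>Box\<close> the exponentials of frequency u + z / M are orthogonal with
  squared norm M^d. As \<Omega> lies in \<open>Box\<close>, the coefficients of its indicator are
  values of its transform; conjugating the exponentials in \<open>e\<close> gives them the right
  sign.\<close>

lemma Bessel_lattice:
  assumes F: "finite F" "F \<subseteq> (\<Pi>\<^sub>E k\<in>{..<d}. UNIV)"
  shows "(\<Sum>z\<in>F. (cmod (ft d \<Omega> (\<lambda>k. u k + of_int (z k) / M)))\<^sup>2) \<le> M ^ d * V"
proof -
  define e where "e z x = indicator Box x * cnj (ex (Rd_inner d (\<lambda>k. u k + of_int (z k) / M) x))"
    for z x
  have fe: "indicator \<Omega> x * cnj (e z x) = indicator \<Omega> x * ex (Rd_inner d (\<lambda>k. u k + of_int (z k) / M) x)" for z x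
    using \<Omega>_sub by (auto simp: e_def indicator_def)
  have ee: "e z x * cnj (e z' x) =
      indicator Box x * ex (Rd_inner d (\<lambda>k. of_int (z' k - z k) / M) x)" for z z' x
  proof -
    have "Rd_inner d (\<lambda>k. of_int (z' k - z k) / M) x =
      Rd_inner d (\<lambda>k. u k + of_int (z' k) / M) x - Rd_inner d (\<lambda>k. u k + of_int (z k) / M) x"
      unfolding Rd_inner_diff[symmetric] by (intro Rd_inner_cong) (simp add: diff_divide_distrib)
    thus ?thesis by (simp add: e_def ex_diff indicator_def)
  qed
  have "(\<Sum>z\<in>F. (cmod (\<integral>x. indicator \<Omega> x * cnj (e z x) \<partial>Rd_borel d))\<^sup>2) \<le>
    M ^ d * (\<integral>x. (cmod (indicator \<Omega> x))\<^sup>2 \<partial>Rd_borel d)"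
  proof (rule Bessel_inequality[OF F(1)])
    show "M ^ d > 0" using M_pos by simp
    show "integrable (Rd_borel d) (\<lambda>x. indicator \<Omega> x * cnj (indicator \<Omega> x :: complex))"
      by (rule integrable_bounded[where B = 1]) (auto simp: indicator_def)
    show "integrable (Rd_borel d) (\<lambda>x. indicator \<Omega> x * cnj (e z x))" for z
      unfolding fe by (rule integrable_bounded[where B = 1]) auto
    fix z z' assume zz: "z \<in> F" "z' \<in> F"
    show "integrable (Rd_borel d) (\<lambda>x. e z x * cnj (e z' x))"
      unfolding ee using M_pos by (intro integral_ex_box) auto
    have "(\<integral>x. e z x * cnj (e z' x) \<partial>Rd_borel d) =
       (\<Prod>k<d. \<integral>x. indicator {0..<M} x * ex (of_int (z' k - z k) / M * x) \<partial>lborel)"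
      unfolding ee using M_pos by (intro integral_ex_box) auto
    also have "\<dots> = (\<Prod>k<d. if z' k - z k = 0 then of_real M else 0)"
      by (simp only: integral_ex_period[OF M_pos])
    also have "\<dots> = (if z = z' then of_real (M ^ d) else 0)"
    proof (cases "z = z'")
      case False
      obtain k where "k < d" "z k \<noteq> z' k"
        using PiE_ext[of z "{..<d}" "\<lambda>_. UNIV" z'] zz F(2) False by blast
      hence "(\<Prod>k<d. if z' k - z k = 0 then complex_of_real M else 0) = 0"
        by (intro prod_zero bexI[of _ k]) auto
      thus ?thesis using False by simp
    qed simp
    finally show "(\<integral>x. e z x * cnj (e z' x) \<partial>Rd_borel d) = (if z = z' then of_real (M ^ d) else 0)" .
  qed
  moreover have "(\<integral>x. (cmod (indicator \<Omega> x))\<^sup>2 \<partial>Rd_borel d) = V"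
    using integral_norm_sq[of "\<lambda>_. 0"] by (simp add: Rd_inner_def)
  ultimately show ?thesis unfolding fe by (simp add: ft_def)
qed

lemma floor_in_cell: "(\<lambda>k\<in>{..<d}. \<xi> k - \<lfloor>\<xi> k * M\<rfloor> / M) \<in> cell"
proof -
  have "0 \<le> \<xi> k - \<lfloor>\<xi> k * M\<rfloor> / M \<and> \<xi> k - \<lfloor>\<xi> k * M\<rfloor> / M < 1 / M" for k
  proof -
    define y where "y = \<xi> k * M - \<lfloor>\<xi> k * M\<rfloor>"
    have "0 \<le> y" "y < 1" unfolding y_def using floor_correct[of "\<xi> k * M"] by linarith+
    hence "0 \<le> y / M" "y / M < 1 / M" using M_pos by (auto intro: divide_strict_right_mono)
    moreover have "\<xi> k - \<lfloor>\<xi> k * M\<rfloor> / M = y / M"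
      using M_pos by (simp add: y_def diff_divide_distrib)
    ultimately show ?thesis by simp
  qed
  thus ?thesis unfolding restrict_PiE_iff atLeastLessThan_iff by blast
qed

text \<open>One half of Plancherel's identity. The translates of \<open>cell\<close> by the points z
  / M cover the space; moving them all onto \<open>cell\<close> leaves the sums bounded by
  \<open>Bessel_lattice\<close>, and the measure M^(-d) of \<open>cell\<close> cancels the factor
  M^d.\<close>

lemma nn_integral_ft_le: "(\<integral>\<^sup>+\<xi>. ennreal ((cmod (ft d \<Omega> \<xi>))\<^sup>2) \<partial>Rd_borel d) \<le> ennreal V"
proof -
  define Z where "Z = (\<Pi>\<^sub>E k\<in>{..<d}. UNIV :: int set)"
  have cZ: "countable Z" unfolding Z_def by (rule countable_PiE) auto
  define s where "s z = (\<lambda>k. of_int (z k) / M)" for z :: "nat \<Rightarrow> int"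
  define \<phi> where "\<phi> \<xi> = ennreal ((cmod (ft d \<Omega> \<xi>))\<^sup>2)" for \<xi>
  have \<phi> [measurable]: "\<phi> \<in> borel_measurable (Rd_borel d)" unfolding \<phi>_def[abs_def] by measurable
  have "(\<integral>\<^sup>+\<xi>. \<phi> \<xi> \<partial>Rd_borel d) \<le>
    (\<integral>\<^sup>+\<xi>. \<integral>\<^sup>+z. \<phi> \<xi> * indicator cell (shift d (\<lambda>k. - s z k) \<xi>) \<partial>count_space Z \<partial>Rd_borel d)"
  proof (rule nn_integral_mono)
    fix \<xi>
    \<comment> \<open>Rounding \<xi> down to mesh 1 / M finds a translate of \<open>cell\<close>
      that contains it; this single term of the sum already gives the inequality.\<close>
    define z where "z = (\<lambda>k\<in>{..<d}. \<lfloor>\<xi> k * M\<rfloor>)"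
    have zZ: "z \<in> Z" by (simp add: z_def Z_def)
    have "shift d (\<lambda>k. - s z k) \<xi> \<in> cell"
    proof -
      have "shift d (\<lambda>k. - s z k) \<xi> = (\<lambda>k\<in>{..<d}. \<xi> k - \<lfloor>\<xi> k * M\<rfloor> / M)"
        unfolding shift_def by (rule restrict_ext) (simp add: s_def z_def)
      thus ?thesis by (simp only: floor_in_cell)
    qed
    hence "\<phi> \<xi> = (\<integral>\<^sup>+z'. \<phi> \<xi> * indicator cell (shift d (\<lambda>k. - s z k) \<xi>) * indicator {z} z' \<partial>count_space Z)"
      using zZ by (subst nn_integral_count_space'[where A = "{z}"]) auto
    also have "\<dots> \<le> (\<integral>\<^sup>+z. \<phi> \<xi> * indicator cell (shift d (\<lambda>k. - s z k) \<xi>) \<partial>count_space Z)"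
      by (intro nn_integral_mono) (auto simp: indicator_def)
    finally show "\<phi> \<xi> \<le> \<dots>" .
  qed
  also have "\<dots> = (\<integral>\<^sup>+z. \<integral>\<^sup>+\<xi>. \<phi> \<xi> * indicator cell (shift d (\<lambda>k. - s z k) \<xi>) \<partial>Rd_borel d \<partial>count_space Z)"
    by (rule nn_integral_count_space_nn_integral[OF cZ])
       (intro borel_measurable_times_ennreal measurable_indicator_shift cell_sets \<phi>)
  also have "\<dots> = (\<integral>\<^sup>+z. \<integral>\<^sup>+\<xi>. \<phi> (shift d (s z) \<xi>) * indicator cell \<xi> \<partial>Rd_borel d \<partial>count_space Z)"
  proof (rule nn_integral_cong)
    fix z
    have "(\<integral>\<^sup>+\<xi>. \<phi> \<xi> * indicator cell (shift d (\<lambda>k. - s z k) \<xi>) \<partial>Rd_borel d) =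
      (\<integral>\<^sup>+\<xi>. \<phi> (shift d (s z) \<xi>) * indicator cell (shift d (\<lambda>k. - s z k) (shift d (s z) \<xi>)) \<partial>Rd_borel d)"
      by (rule nn_integral_shift[where f = "\<lambda>\<xi>. \<phi> \<xi> * indicator cell (shift d (\<lambda>k. - s z k) \<xi>)", symmetric])
         (intro borel_measurable_times_ennreal measurable_indicator_shift cell_sets \<phi>)
    also have "\<dots> = (\<integral>\<^sup>+\<xi>. \<phi> (shift d (s z) \<xi>) * indicator cell \<xi> \<partial>Rd_borel d)"
    proof (rule nn_integral_cong)
      fix \<xi> assume "\<xi> \<in> space (Rd_borel d)"
      hence "shift d (\<lambda>k. - s z k) (shift d (s z) \<xi>) = \<xi>"
        by (intro shift_uminus_shift) (simp only: space_Rd_borel)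
      thus "\<phi> (shift d (s z) \<xi>) * indicator cell (shift d (\<lambda>k. - s z k) (shift d (s z) \<xi>)) =
        \<phi> (shift d (s z) \<xi>) * indicator cell \<xi>" by simp
    qed
    finally show "(\<integral>\<^sup>+\<xi>. \<phi> \<xi> * indicator cell (shift d (\<lambda>k. - s z k) \<xi>) \<partial>Rd_borel d) = \<dots>" .
  qed
  also have "\<dots> = (\<integral>\<^sup>+\<xi>. \<integral>\<^sup>+z. \<phi> (shift d (s z) \<xi>) * indicator cell \<xi> \<partial>count_space Z \<partial>Rd_borel d)"
    by (rule nn_integral_count_space_nn_integral[OF cZ, symmetric])
       (intro borel_measurable_times_ennreal measurable_compose[OF measurable_shift \<phi>]
          borel_measurable_indicator cell_sets)
  also have "\<dots> \<le> (\<integral>\<^sup>+\<xi>. ennreal (M ^ d * V) * indicator cell \<xi> \<partial>Rd_borel d)"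
  proof (rule nn_integral_mono)
    fix \<xi>
    have "(\<integral>\<^sup>+z. \<phi> (shift d (s z) \<xi>) \<partial>count_space Z) \<le> ennreal (M ^ d * V)"
    proof (rule nn_integral_count_space_le[OF cZ])
      fix F assume F: "finite F" "F \<subseteq> Z"
      have "(\<Sum>z\<in>F. \<phi> (shift d (s z) \<xi>)) = ennreal (\<Sum>z\<in>F. (cmod (ft d \<Omega> (\<lambda>k. \<xi> k + of_int (z k) / M)))\<^sup>2)"
        unfolding \<phi>_def s_def
        by (subst sum_ennreal[symmetric]) (auto intro!: sum.cong arg_cong[where f = ennreal]
            arg_cong[where f = "\<lambda>z. (cmod z)\<^sup>2"] ft_cong)
      also have "\<dots> \<le> ennreal (M ^ d * V)"
        using F by (intro ennreal_leI Bessel_lattice) (auto simp: Z_def)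
      finally show "(\<Sum>z\<in>F. \<phi> (shift d (s z) \<xi>)) \<le> ennreal (M ^ d * V)" .
    qed
    thus "(\<integral>\<^sup>+z. \<phi> (shift d (s z) \<xi>) * indicator cell \<xi> \<partial>count_space Z) \<le> ennreal (M ^ d * V) * indicator cell \<xi>"
      by (auto simp: indicator_def)
  qed
  also have "\<dots> = ennreal (M ^ d * V) * emeasure (Rd_borel d) cell"
    by (rule nn_integral_cmult_indicator) measurable
  also have "emeasure (Rd_borel d) cell = ennreal ((1 / M) ^ d)"
    using M_pos by (subst lborel_product.emeasure_PiM) (auto simp: ennreal_power)
  also have "ennreal (M ^ d * V) * ennreal ((1 / M) ^ d) = ennreal V"
    using M_pos by (simp add: ennreal_mult[symmetric] power_divide)
  finally show ?thesis unfolding \<phi>_def .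
qed

text \<open>The two facts about a spectrum on which the density argument rests: differences of its
  points are zeros of the transform, and Parseval's lower bound holds for the exponential of every
  frequency \<xi>, in \<Lambda> or not.\<close>

lemma spectral_imp:
  assumes "spectral d \<Omega>"
  obtains \<Lambda> where "\<Lambda> \<subseteq> Rd d"
    "\<forall>l\<in>\<Lambda>. \<forall>l'\<in>\<Lambda>. l \<noteq> l' \<longrightarrow> ft d \<Omega> (\<lambda>k. l k - l' k) = 0"
    "\<And>\<xi> \<epsilon>. \<epsilon> > 0 \<Longrightarrow> \<exists>F. finite F \<and> F \<subseteq> \<Lambda> \<and>
      V\<^sup>2 - \<epsilon> \<le> (\<Sum>l\<in>F. (cmod (ft d \<Omega> (\<lambda>k. \<xi> k - l k)))\<^sup>2)"
    "V > 0"
proof -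
  define E where "E l x = exp (2 * of_real pi * \<i> * of_real (Rd_inner d l x))" for l x
  have E: "E l x = ex (Rd_inner d l x)" for l x by (simp add: E_def ex_exp)
  from assms obtain \<Lambda> where pos: "positive_finite_measure_set d \<Omega>" and \<Lambda>: "\<Lambda> \<subseteq> Rd d"
    and basis: "L2_orthogonal_basis (Rd_lebesgue d) \<Omega> \<Lambda> E"
    unfolding spectral_def E_def[abs_def] by blast
  have V: "V > 0"
    using pos emeasure_finite
    by (simp add: positive_finite_measure_set_def Rd_lebesgue_def measure_def enn2real_positive_iff)
  have orth: "ft d \<Omega> (\<lambda>k. l k - l' k) = 0" if "l \<in> \<Lambda>" "l' \<in> \<Lambda>" "l \<noteq> l'" for l l'
  proof -
    have "L2_inner (Rd_lebesgue d) \<Omega> (E l) (E l') = 0"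
      using basis that unfolding L2_orthogonal_basis_def by blast
    also have "L2_inner (Rd_lebesgue d) \<Omega> (E l) (E l') =
        (\<integral>x. indicator \<Omega> x *\<^sub>R ex (Rd_inner d (\<lambda>k. l k - l' k) x) \<partial>Rd_borel d)"
      unfolding L2_inner_def Rd_lebesgue_def set_lebesgue_integral_def E ex_diff[symmetric] Rd_inner_diff[symmetric]
      by (rule integral_completion) measurable
    also have "\<dots> = ft d \<Omega> (\<lambda>k. l k - l' k)"
      unfolding ft_def by (intro Bochner_Integration.integral_cong) (auto simp: indicator_def)
    finally show ?thesis .
  qed
  have approx: "\<exists>F. finite F \<and> F \<subseteq> \<Lambda> \<and> V\<^sup>2 - \<epsilon> \<le> (\<Sum>l\<in>F. (cmod (ft d \<Omega> (\<lambda>k. \<xi> k - l k)))\<^sup>2)"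
    if "\<epsilon> > 0" for \<xi> \<epsilon>
  proof -
    have "E \<xi> \<in> L2 (Rd_lebesgue d) \<Omega>"
    proof -
      have "integrable (Rd_borel d) (\<lambda>x. indicat_real \<Omega> x * 1)"
        by (rule integrable_bounded[where B = 1]) auto
      hence "integrable (completion (Rd_borel d)) (\<lambda>x. indicat_real \<Omega> x * 1)"
        by (subst integrable_completion) auto
      moreover have "(\<lambda>x. indicator \<Omega> x *\<^sub>R E \<xi> x) \<in> borel_measurable (completion (Rd_borel d))"
        unfolding E by (rule measurable_completion) measurable
      ultimately show ?thesis
        by (simp add: L2_def set_integrable_def set_borel_measurable_def Rd_lebesgue_def E)
    qed
    \<comment> \<open>All exponentials have squared norm V, so this tolerance becomes exactly
      \<epsilon> after squaring and multiplying by V.\<close>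
    moreover have "sqrt (\<epsilon> / V) > 0" using that V by simp
    ultimately obtain F c where F: "finite F" "F \<subseteq> \<Lambda>" and
      le: "L2_norm (Rd_lebesgue d) \<Omega> (\<lambda>x. E \<xi> x - (\<Sum>i\<in>F. c i * E i x)) < sqrt (\<epsilon> / V)"
      using basis unfolding L2_orthogonal_basis_def by blast
    define e where "e l x = indicator \<Omega> x * ex (Rd_inner d l x)" for l x
    have "L2_norm (Rd_lebesgue d) \<Omega> (\<lambda>x. E \<xi> x - (\<Sum>i\<in>F. c i * E i x)) =
      sqrt (\<integral>x. indicator \<Omega> x *\<^sub>R (cmod (E \<xi> x - (\<Sum>i\<in>F. c i * E i x)))\<^sup>2 \<partial>Rd_borel d)"
      unfolding L2_norm_def Rd_lebesgue_def set_lebesgue_integral_def E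
      by (subst integral_completion) auto
    also have "(\<integral>x. indicator \<Omega> x *\<^sub>R (cmod (E \<xi> x - (\<Sum>i\<in>F. c i * E i x)))\<^sup>2 \<partial>Rd_borel d) =
       (\<integral>x. (cmod (e \<xi> x - (\<Sum>i\<in>F. c i * e i x)))\<^sup>2 \<partial>Rd_borel d)"
      unfolding E e_def by (intro Bochner_Integration.integral_cong) (auto simp: indicator_def)
    finally have "(\<integral>x. (cmod (e \<xi> x - (\<Sum>i\<in>F. c i * e i x)))\<^sup>2 \<partial>Rd_borel d) < \<epsilon> / V"
      using le by simp
    moreover have "(\<integral>x. (cmod (e \<xi> x))\<^sup>2 \<partial>Rd_borel d) -
       (\<Sum>i\<in>F. (cmod (\<integral>x. e \<xi> x * cnj (e i x) \<partial>Rd_borel d))\<^sup>2) / V \<le>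
       (\<integral>x. (cmod (e \<xi> x - (\<Sum>i\<in>F. c i * e i x)))\<^sup>2 \<partial>Rd_borel d)"
    proof (rule best_approximation[OF F(1) V])
      show "(\<integral>x. e i x * cnj (e j x) \<partial>Rd_borel d) = (if i = j then of_real V else 0)"
        if "i \<in> F" "j \<in> F" for i j
        using that F(2) orth[of i j] unfolding e_def ft_diff by (auto simp: ft_0)
    qed (simp_all only: e_def integrable_products)
    ultimately have "V - (\<Sum>l\<in>F. (cmod (ft d \<Omega> (\<lambda>k. \<xi> k - l k)))\<^sup>2) / V \<le> \<epsilon> / V"
      by (simp only: e_def integral_norm_sq ft_diff)
    hence "V * (V - (\<Sum>l\<in>F. (cmod (ft d \<Omega> (\<lambda>k. \<xi> k - l k)))\<^sup>2) / V) \<le> V * (\<epsilon> / V)"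
      using V by (intro mult_left_mono) auto
    hence "V\<^sup>2 - \<epsilon> \<le> (\<Sum>l\<in>F. (cmod (ft d \<Omega> (\<lambda>k. \<xi> k - l k)))\<^sup>2)"
      using V by (simp add: right_diff_distrib power2_eq_square)
    thus ?thesis using F by blast
  qed
  show thesis by (rule that[OF \<Lambda> _ approx V]) (use orth in blast)
qed

text \<open>The spectrum \<open>\<Lambda>\<close> has density \<open>V\<close>, so some translate of \<open>W\<close> contains at least
  \<open>V |W|\<close> of its points.\<close>

lemma not_spectral:
  assumes W [measurable]: "W \<in> sets (Rd_borel d)" and cell: "cell \<subseteq> W"
    and fin: "\<And>\<Lambda> u. \<Lambda> \<subseteq> Rd d \<Longrightarrow>
      \<forall>l\<in>\<Lambda>. \<forall>l'\<in>\<Lambda>. l \<noteq> l' \<longrightarrow> ft d \<Omega> (\<lambda>k. l k - l' k) = 0 \<Longrightarrow>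
      finite {l \<in> \<Lambda>. shift d u l \<in> W} \<and> card {l \<in> \<Lambda>. shift d u l \<in> W} \<le> \<kappa>"
    and gt: "ennreal (real \<kappa>) < ennreal V * emeasure (Rd_borel d) W"
  shows "\<not> spectral d \<Omega>"
proof
  assume "spectral d \<Omega>"
  then obtain \<Lambda> where \<Lambda>: "\<Lambda> \<subseteq> Rd d"
    and orth: "\<forall>l\<in>\<Lambda>. \<forall>l'\<in>\<Lambda>. l \<noteq> l' \<longrightarrow> ft d \<Omega> (\<lambda>k. l k - l' k) = 0"
    and approx: "\<And>\<xi> \<epsilon>. \<epsilon> > 0 \<Longrightarrow> \<exists>F. finite F \<and> F \<subseteq> \<Lambda> \<and>
      V\<^sup>2 - \<epsilon> \<le> (\<Sum>l\<in>F. (cmod (ft d \<Omega> (\<lambda>k. \<xi> k - l k)))\<^sup>2)"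
    and V: "V > 0"
    by (rule spectral_imp) (rule that)
  have fin: "finite {l \<in> \<Lambda>. shift d u l \<in> W}" "card {l \<in> \<Lambda>. shift d u l \<in> W} \<le> \<kappa>" for u
    using fin[OF \<Lambda> orth, of u] by simp_all
  define Z where "Z = (\<Pi>\<^sub>E k\<in>{..<d}. UNIV :: int set)"
  have cZ: "countable Z" unfolding Z_def by (rule countable_PiE) auto
  \<comment> \<open>Sums over \<Lambda> can be exchanged with integrals once \<Lambda> is countable:
    countably many translates of \<open>cell\<close> cover it, and each contains finitely many of
    its points because \<open>cell\<close> lies in W.\<close>
  have "\<Lambda> \<subseteq> (\<Union>z\<in>Z. {l \<in> \<Lambda>. shift d (\<lambda>k. - of_int (z k) / M) l \<in> W})"
  proof
    fix l assume l: "l \<in> \<Lambda>"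
    define z where "z = (\<lambda>k\<in>{..<d}. \<lfloor>l k * M\<rfloor>)"
    have "shift d (\<lambda>k. - of_int (z k) / M) l \<in> cell"
    proof -
      have "shift d (\<lambda>k. - of_int (z k) / M) l = (\<lambda>k\<in>{..<d}. l k - \<lfloor>l k * M\<rfloor> / M)"
        unfolding shift_def by (rule restrict_ext) (simp add: z_def)
      thus ?thesis by (simp only: floor_in_cell)
    qed
    moreover have "z \<in> Z" by (simp add: z_def Z_def)
    ultimately show "l \<in> (\<Union>z\<in>Z. {l \<in> \<Lambda>. shift d (\<lambda>k. - of_int (z k) / M) l \<in> W})"
      using cell l by blast
  qed
  moreover have "countable (\<Union>z\<in>Z. {l \<in> \<Lambda>. shift d (\<lambda>k. - of_int (z k) / M) l \<in> W})"
    using cZ fin(1) by (intro countable_UN) (auto intro: countable_finite)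
  ultimately have c\<Lambda>: "countable \<Lambda>" by (rule countable_subset)
  define \<phi> where "\<phi> \<xi> = ennreal ((cmod (ft d \<Omega> \<xi>))\<^sup>2)" for \<xi>
  have \<phi> [measurable]: "\<phi> \<in> borel_measurable (Rd_borel d)" unfolding \<phi>_def[abs_def] by measurable
  have Parseval: "ennreal (V\<^sup>2) \<le> (\<integral>\<^sup>+l. \<phi> (shift d (\<lambda>k. - l k) \<xi>) \<partial>count_space \<Lambda>)" for \<xi>
  proof (rule ennreal_le_epsilon)
    fix \<epsilon> :: real assume "\<epsilon> > 0"
    from approx[OF this, of \<xi>] obtain F where F: "finite F" "F \<subseteq> \<Lambda>"
      and le: "V\<^sup>2 - \<epsilon> \<le> (\<Sum>l\<in>F. (cmod (ft d \<Omega> (\<lambda>k. \<xi> k - l k)))\<^sup>2)" by blast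
    have "ennreal (V\<^sup>2) \<le> ennreal ((\<Sum>l\<in>F. (cmod (ft d \<Omega> (\<lambda>k. \<xi> k - l k)))\<^sup>2) + \<epsilon>)"
      using le by (intro ennreal_leI) simp
    also have "\<dots> = ennreal (\<Sum>l\<in>F. (cmod (ft d \<Omega> (\<lambda>k. \<xi> k - l k)))\<^sup>2) + ennreal \<epsilon>"
      using \<open>\<epsilon> > 0\<close> by (intro ennreal_plus sum_nonneg) auto
    also have "ennreal (\<Sum>l\<in>F. (cmod (ft d \<Omega> (\<lambda>k. \<xi> k - l k)))\<^sup>2) =
      (\<Sum>l\<in>F. \<phi> (shift d (\<lambda>k. - l k) \<xi>))"
      unfolding \<phi>_def by (subst sum_ennreal[symmetric]) (auto intro!: sum.cong
          arg_cong[where f = ennreal] arg_cong[where f = "\<lambda>z. (cmod z)\<^sup>2"] ft_cong)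
    also have "\<dots> = (\<integral>\<^sup>+l. \<phi> (shift d (\<lambda>k. - l k) \<xi>) * indicator F l \<partial>count_space \<Lambda>)"
      using F by (subst nn_integral_count_space'[where A = F]) auto
    also have "\<dots> \<le> (\<integral>\<^sup>+l. \<phi> (shift d (\<lambda>k. - l k) \<xi>) \<partial>count_space \<Lambda>)"
      by (intro nn_integral_mono) (auto simp: indicator_def)
    finally show "ennreal (V\<^sup>2) \<le> (\<integral>\<^sup>+l. \<phi> (shift d (\<lambda>k. - l k) \<xi>) \<partial>count_space \<Lambda>) + ennreal \<epsilon>"
      by (simp add: add_right_mono)
  qed
  \<comment> \<open>Double counting: the Parseval bound is integrated over W, the sum is taken
    outside, and each term is translated by its l. Then |ft|^2 at \<xi> is weighted by the number of
    points l with \<xi> + l in W, which is at most \<kappa>, and its total integral is at most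
    V.\<close>
  have "ennreal (V\<^sup>2) * emeasure (Rd_borel d) W = (\<integral>\<^sup>+\<xi>. ennreal (V\<^sup>2) * indicator W \<xi> \<partial>Rd_borel d)"
    by (rule nn_integral_cmult_indicator[symmetric]) measurable
  also have "\<dots> \<le> (\<integral>\<^sup>+\<xi>. \<integral>\<^sup>+l. \<phi> (shift d (\<lambda>k. - l k) \<xi>) * indicator W \<xi> \<partial>count_space \<Lambda> \<partial>Rd_borel d)"
    by (rule nn_integral_mono) (use Parseval in \<open>auto simp: indicator_def\<close>)
  also have "\<dots> = (\<integral>\<^sup>+l. \<integral>\<^sup>+\<xi>. \<phi> (shift d (\<lambda>k. - l k) \<xi>) * indicator W \<xi> \<partial>Rd_borel d \<partial>count_space \<Lambda>)"
    by (rule nn_integral_count_space_nn_integral[OF c\<Lambda>])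
       (intro borel_measurable_times_ennreal measurable_compose[OF measurable_shift \<phi>]
          borel_measurable_indicator W)
  also have "\<dots> = (\<integral>\<^sup>+l. \<integral>\<^sup>+\<xi>. \<phi> \<xi> * indicator W (shift d \<xi> l) \<partial>Rd_borel d \<partial>count_space \<Lambda>)"
  proof (rule nn_integral_cong)
    fix l
    have "(\<integral>\<^sup>+\<xi>. \<phi> (shift d (\<lambda>k. - l k) \<xi>) * indicator W \<xi> \<partial>Rd_borel d) =
      (\<integral>\<^sup>+\<xi>. \<phi> (shift d (\<lambda>k. - l k) (shift d l \<xi>)) * indicator W (shift d l \<xi>) \<partial>Rd_borel d)"
      by (rule nn_integral_shift[where f = "\<lambda>\<xi>. \<phi> (shift d (\<lambda>k. - l k) \<xi>) * indicator W \<xi>", symmetric])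
         (intro borel_measurable_times_ennreal measurable_compose[OF measurable_shift \<phi>]
          borel_measurable_indicator W)
    also have "\<dots> = (\<integral>\<^sup>+\<xi>. \<phi> \<xi> * indicator W (shift d \<xi> l) \<partial>Rd_borel d)"
    proof (rule nn_integral_cong)
      fix \<xi> assume "\<xi> \<in> space (Rd_borel d)"
      hence "shift d (\<lambda>k. - l k) (shift d l \<xi>) = \<xi>"
        by (intro shift_uminus_shift) (simp only: space_Rd_borel)
      moreover have "shift d l \<xi> = shift d \<xi> l" by (auto simp: shift_def)
      ultimately show "\<phi> (shift d (\<lambda>k. - l k) (shift d l \<xi>)) * indicator W (shift d l \<xi>) =
        \<phi> \<xi> * indicator W (shift d \<xi> l)" by simp
    qed
    finally show "(\<integral>\<^sup>+\<xi>. \<phi> (shift d (\<lambda>k. - l k) \<xi>) * indicator W \<xi> \<partial>Rd_borel d) = \<dots>" .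
  qed
  also have "\<dots> = (\<integral>\<^sup>+\<xi>. \<integral>\<^sup>+l. \<phi> \<xi> * indicator W (shift d \<xi> l) \<partial>count_space \<Lambda> \<partial>Rd_borel d)"
  proof (rule nn_integral_count_space_nn_integral[OF c\<Lambda>, symmetric])
    fix l
    have "shift d \<xi> l = shift d l \<xi>" for \<xi> by (auto simp: shift_def)
    thus "(\<lambda>\<xi>. \<phi> \<xi> * indicator W (shift d \<xi> l)) \<in> borel_measurable (Rd_borel d)"
      by (simp only:) (intro borel_measurable_times_ennreal measurable_indicator_shift W \<phi>)
  qed
  also have "\<dots> \<le> (\<integral>\<^sup>+\<xi>. ennreal (real \<kappa>) * \<phi> \<xi> \<partial>Rd_borel d)"
  proof (rule nn_integral_mono)
    fix \<xi>
    let ?F = "{l \<in> \<Lambda>. shift d \<xi> l \<in> W}"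
    have "(\<integral>\<^sup>+l. \<phi> \<xi> * indicator W (shift d \<xi> l) \<partial>count_space \<Lambda>) =
      (\<Sum>l\<in>?F. \<phi> \<xi> * indicator W (shift d \<xi> l))"
      using fin(1) by (intro nn_integral_count_space') auto
    also have "\<dots> = of_nat (card ?F) * \<phi> \<xi>" by simp
    also have "\<dots> \<le> of_nat \<kappa> * \<phi> \<xi>"
      using fin(2) by (intro mult_right_mono of_nat_mono) auto
    finally show "(\<integral>\<^sup>+l. \<phi> \<xi> * indicator W (shift d \<xi> l) \<partial>count_space \<Lambda>) \<le> ennreal (real \<kappa>) * \<phi> \<xi>"
      by (simp add: ennreal_of_nat_eq_real_of_nat)
  qed
  also have "\<dots> = ennreal (real \<kappa>) * (\<integral>\<^sup>+\<xi>. \<phi> \<xi> \<partial>Rd_borel d)"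
    by (rule nn_integral_cmult) measurable
  also have "\<dots> \<le> ennreal (real \<kappa>) * ennreal V"
    using nn_integral_ft_le unfolding \<phi>_def by (rule mult_left_mono) simp
  finally have "ennreal V * (ennreal V * emeasure (Rd_borel d) W) \<le> ennreal V * ennreal (real \<kappa>)"
    using V by (simp add: power2_eq_square ennreal_mult mult_ac)
  hence "ennreal V * emeasure (Rd_borel d) W \<le> ennreal (real \<kappa>)"
    using V by (subst (asm) ennreal_mult_le_mult_iff) auto
  with gt show False by simp
qed

end

section \<open>Unions of unit cubes\<close>

definition int_box :: "nat \<Rightarrow> (nat \<Rightarrow> int) \<Rightarrow> (nat \<Rightarrow> int) \<Rightarrow> (nat \<Rightarrow> real) set" where
  "int_box d a b = (\<Pi>\<^sub>E k\<in>{..<d}. {of_int (a k)<..<of_int (b k)})"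

text \<open>Up to a null set, the union of the unit cubes with corners in \<open>N\<close>; faces shared by cubes
  of \<open>N\<close> are included, so that it is the interior of the union of the closed cubes.\<close>
definition cubes :: "nat \<Rightarrow> (nat \<Rightarrow> int) set \<Rightarrow> (nat \<Rightarrow> real) set" where
  "cubes d N = \<Union> {int_box d a b | a b. (\<Pi>\<^sub>E k\<in>{..<d}. {a k..<b k}) \<subseteq> N}"

definition corner :: "nat \<Rightarrow> (nat \<Rightarrow> real) \<Rightarrow> nat \<Rightarrow> int" where
  "corner d x = (\<lambda>k\<in>{..<d}. \<lfloor>x k\<rfloor>)"

lemma corner_in_int_box:
  assumes "x \<in> int_box d a b"
  shows "corner d x \<in> (\<Pi>\<^sub>E k\<in>{..<d}. {a k..<b k})"
proof -
  have "a k \<le> \<lfloor>x k\<rfloor> \<and> \<lfloor>x k\<rfloor> < b k" if "k < d" for k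
  proof -
    have "of_int (a k) < x k" "x k < of_int (b k)"
      using assms that by (auto simp: int_box_def PiE_iff)
    thus ?thesis by (simp add: le_floor_iff floor_less_iff)
  qed
  thus ?thesis by (simp add: corner_def PiE_iff)
qed

lemma corner_in_of_cubes: "x \<in> cubes d N \<Longrightarrow> corner d x \<in> N"
  using corner_in_int_box unfolding cubes_def by blast

lemma cubes_subset_Rd: "cubes d N \<subseteq> Rd d"
  unfolding cubes_def int_box_def by (auto simp: PiE_iff)

text \<open>Off the faces a point lies in the open unit cube over its corner, and that cube is
  itself one of the boxes in the union.\<close>

lemma in_cubesI:
  assumes "x \<in> Rd d" "\<And>k. k < d \<Longrightarrow> x k \<notin> \<int>" "corner d x \<in> N"
  shows "x \<in> cubes d N"
proof -
  define n where "n = corner d x"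
  have "m = n" if "m \<in> (\<Pi>\<^sub>E k\<in>{..<d}. {n k..<n k + 1})" for m
  proof (rule PiE_ext)
    show "m k = n k" if "k \<in> {..<d}" for k
      using PiE_mem[OF \<open>m \<in> _\<close> that] by simp
    show "m \<in> (\<Pi>\<^sub>E k\<in>{..<d}. UNIV)" using that by (simp add: PiE_iff)
  qed (simp add: n_def corner_def)
  hence "(\<Pi>\<^sub>E k\<in>{..<d}. {n k..<n k + 1}) \<subseteq> N" using assms(3) by (auto simp: n_def)
  moreover have "x \<in> int_box d n (\<lambda>k. n k + 1)"
  proof -
    have "of_int \<lfloor>x k\<rfloor> < x k \<and> x k < of_int (\<lfloor>x k\<rfloor> + 1)" if "k < d" for k
    proof -
      have "of_int \<lfloor>x k\<rfloor> \<noteq> x k" using assms(2)[OF that] by (metis Ints_of_int)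
      thus ?thesis using floor_correct[of "x k"] by linarith
    qed
    thus ?thesis using assms(1) by (simp add: int_box_def n_def corner_def PiE_iff)
  qed
  ultimately show ?thesis unfolding cubes_def by blast
qed

lemma in_cubes_iff:
  "x \<in> Rd d \<Longrightarrow> (\<And>k. k < d \<Longrightarrow> x k \<notin> \<int>) \<Longrightarrow> x \<in> cubes d N \<longleftrightarrow> corner d x \<in> N"
  by (rule iffI[OF corner_in_of_cubes in_cubesI])

lemma openin_int_box: "openin (Rd_top d) (int_box d a b)"
  unfolding Rd_top_def int_box_def by (subst openin_PiE) auto

lemma connectedin_int_box: "connectedin (Rd_top d) (int_box d a b)"
  unfolding Rd_top_def int_box_def by (subst connectedin_PiE) (auto intro: convex_connected)

lemma openin_cubes: "openin (Rd_top d) (cubes d N)"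
  unfolding cubes_def using openin_int_box by blast

lemma cubes_sets: "cubes d N \<in> sets (Rd_borel d)"
proof -
  define Z where "Z = (\<Pi>\<^sub>E k\<in>{..<d}. UNIV :: int set)"
  have cZ: "countable Z" unfolding Z_def by (rule countable_PiE) auto
  \<comment> \<open>The indices are functions on all of \<open>nat\<close>, hence uncountably many;
    only their restrictions to the first d coordinates affect the box.\<close>
  have "{int_box d a b | a b. (\<Pi>\<^sub>E k\<in>{..<d}. {a k..<b k}) \<subseteq> N} \<subseteq> (\<lambda>(a, b). int_box d a b) ` (Z \<times> Z)"
  proof clarify
    fix a b :: "nat \<Rightarrow> int"
    have "int_box d a b = int_box d (restrict a {..<d}) (restrict b {..<d})"
      unfolding int_box_def by (rule PiE_cong) simp
    moreover have "restrict a {..<d} \<in> Z" "restrict b {..<d} \<in> Z" by (simp_all add: Z_def)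
    ultimately show "int_box d a b \<in> (\<lambda>(a, b). int_box d a b) ` (Z \<times> Z)" by force
  qed
  hence "countable {int_box d a b | a b. (\<Pi>\<^sub>E k\<in>{..<d}. {a k..<b k}) \<subseteq> N}"
    using cZ by (meson countable_SIGMA countable_image countable_subset)
  thus ?thesis unfolding cubes_def
    by (intro sets.countable_Union) (auto simp: int_box_def intro!: box_in_sets)
qed

lemma cubes_subset_box:
  assumes "N \<subseteq> (\<Pi>\<^sub>E k\<in>{..<d}. {0..<m})"
  shows "cubes d N \<subseteq> (\<Pi>\<^sub>E k\<in>{..<d}. {0..<of_int m})"
proof
  fix x assume x: "x \<in> cubes d N"
  hence "corner d x \<in> (\<Pi>\<^sub>E k\<in>{..<d}. {0..<m})" using corner_in_of_cubes assms by blast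
  hence "0 \<le> \<lfloor>x k\<rfloor> \<and> \<lfloor>x k\<rfloor> < m" if "k < d" for k
    using that by (auto simp: corner_def PiE_iff)
  hence "x k \<in> {0..<of_int m}" if "k < d" for k
    using that by (simp add: floor_less_iff)
  moreover have "x \<in> Rd d" using x cubes_subset_Rd by blast
  ultimately show "x \<in> (\<Pi>\<^sub>E k\<in>{..<d}. {0..<of_int m})" by (simp add: PiE_iff)
qed

text \<open>Almost every point of the set lies in exactly one half-open unit cube with corner in N,
  and each such cube contributes the transform of the standard one times a phase.\<close>

lemma ft_cubes:
  assumes N: "finite N" "N \<subseteq> (\<Pi>\<^sub>E k\<in>{..<d}. UNIV)"
  shows "ft d (cubes d N) \<xi> = (\<Prod>k<d. unit_ft (\<xi> k)) * (\<Sum>n\<in>N. \<Prod>k<d. ex (\<xi> k * of_int (n k)))"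
proof -
  let ?C = "\<lambda>n. \<Pi>\<^sub>E k\<in>{..<d}. {of_int (n k)..<of_int (n k) + 1 :: real}"
  have "ft d (cubes d N) \<xi> = (\<integral>x. (\<Sum>n\<in>N. indicator (?C n) x * ex (Rd_inner d \<xi> x)) \<partial>Rd_borel d)"
    unfolding ft_def
  proof (rule integral_cong_AE)
    show "(\<lambda>x. indicator (cubes d N) x * ex (Rd_inner d \<xi> x)) \<in> borel_measurable (Rd_borel d)"
      using cubes_sets by measurable
    have "?C n \<in> sets (Rd_borel d)" for n by (intro box_in_sets) auto
    thus "(\<lambda>x. \<Sum>n\<in>N. indicator (?C n) x * ex (Rd_inner d \<xi> x)) \<in> borel_measurable (Rd_borel d)"
      by measurable
    have "AE x in Rd_borel d. x \<in> space (Rd_borel d)" by (rule AE_space)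
    with AE_coordinates_not_Ints
    show "AE x in Rd_borel d. indicator (cubes d N) x * ex (Rd_inner d \<xi> x) =
        (\<Sum>n\<in>N. indicator (?C n) x * ex (Rd_inner d \<xi> x))"
    proof eventually_elim
      fix x assume x: "\<forall>k<d. x k \<notin> \<int>" "x \<in> space (Rd_borel d)"
      have xR: "x \<in> Rd d" using x(2) by (simp only: space_Rd_borel)
      have "x \<in> ?C n \<longleftrightarrow> n = corner d x" if "n \<in> N" for n
      proof
        assume "n = corner d x"
        thus "x \<in> ?C n" using xR by (simp add: PiE_iff corner_def)
      next
        assume C: "x \<in> ?C n"
        show "n = corner d x"
        proof (rule PiE_ext)
          show "n \<in> (\<Pi>\<^sub>E k\<in>{..<d}. UNIV)" using that N(2) by blast
          fix k assume "k \<in> {..<d}"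
          with PiE_mem[OF C this] floor_unique[of "n k" "x k"] show "n k = corner d x k"
            by (simp add: corner_def)
        qed (simp add: corner_def)
      qed
      hence "(\<Sum>n\<in>N. indicator (?C n) x * ex (Rd_inner d \<xi> x)) =
          (\<Sum>n\<in>N. if n = corner d x then ex (Rd_inner d \<xi> x) else 0)"
        by (intro sum.cong) (simp_all add: indicator_def)
      also have "\<dots> = indicator (cubes d N) x * ex (Rd_inner d \<xi> x)"
        using N(1) in_cubes_iff[OF xR, of N] x(1) by (simp add: indicator_def)
      finally show "indicator (cubes d N) x * ex (Rd_inner d \<xi> x) =
        (\<Sum>n\<in>N. indicator (?C n) x * ex (Rd_inner d \<xi> x))" by (rule sym)
    qed
  qed
  also have "\<dots> = (\<Sum>n\<in>N. \<integral>x. indicator (?C n) x * ex (Rd_inner d \<xi> x) \<partial>Rd_borel d)"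
    by (rule Bochner_Integration.integral_sum) (rule integral_ex_box, simp)
  also have "\<dots> = (\<Sum>n\<in>N. \<Prod>k<d. ex (\<xi> k * of_int (n k)) * unit_ft (\<xi> k))"
  proof (rule sum.cong[OF refl])
    fix n
    have "(\<integral>x. indicator (?C n) x * ex (Rd_inner d \<xi> x) \<partial>Rd_borel d) =
      (\<Prod>k<d. \<integral>x. indicator {of_int (n k)..<of_int (n k) + 1} x * ex (\<xi> k * x) \<partial>lborel)"
      by (rule integral_ex_box) simp
    thus "(\<integral>x. indicator (?C n) x * ex (Rd_inner d \<xi> x) \<partial>Rd_borel d) =
      (\<Prod>k<d. ex (\<xi> k * of_int (n k)) * unit_ft (\<xi> k))"
      by (simp only: integral_ex_unit)
  qed
  also have "\<dots> = (\<Prod>k<d. unit_ft (\<xi> k)) * (\<Sum>n\<in>N. \<Prod>k<d. ex (\<xi> k * of_int (n k)))"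
    by (simp add: prod.distrib sum_distrib_left mult.commute)
  finally show ?thesis .
qed

section \<open>Connectedness through paths in the integer grid\<close>

definition grid_edges :: "nat \<Rightarrow> (nat \<Rightarrow> int) set \<Rightarrow> ((nat \<Rightarrow> int) \<times> (nat \<Rightarrow> int)) set" where
  "grid_edges d N = {(n, n(k := n k - 1)) | n k. k < d \<and> n \<in> N \<and> n(k := n k - 1) \<in> N}"

text \<open>Two adjacent unit cubes form a box whose only corners are theirs, so the open box,
  common face included, belongs to the union and connects the two centres. Every point is connected
  to the centre of the unit cube over its corner inside any box of the family that contains
  it.\<close>

lemma connectedin_cubes:
  assumes N: "N \<subseteq> (\<Pi>\<^sub>E k\<in>{..<d}. UNIV)"
    and conn: "\<And>n. n \<in> N \<Longrightarrow> (n, n\<^sub>0) \<in> (grid_edges d N \<union> (grid_edges d N)\<inverse>)\<^sup>*"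
  shows "connectedin (Rd_top d) (cubes d N)"
proof -
  define T where "T = subtopology (Rd_top d) (cubes d N)"
  define c where "c n = (\<lambda>k\<in>{..<d}. of_int (n k) + 1 / 2 :: real)" for n :: "nat \<Rightarrow> int"
  have ts: "topspace (Rd_top d) = Rd d" by (simp add: Rd_top_def)
  have c_box: "c n \<in> int_box d a b" if "\<And>k. k < d \<Longrightarrow> a k \<le> n k \<and> n k < b k" for n a b
  proof -
    have "of_int (a k) < real_of_int (n k) + 1 / 2 \<and> real_of_int (n k) + 1 / 2 < of_int (b k)" if "k < d" for k
      using \<open>\<And>k. k < d \<Longrightarrow> a k \<le> n k \<and> n k < b k\<close>[OF that] by linarith
    thus ?thesis by (simp add: int_box_def c_def PiE_iff)
  qed
  have same: "connected_component_of T x y"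
    if "x \<in> int_box d a b" "y \<in> int_box d a b" "(\<Pi>\<^sub>E k\<in>{..<d}. {a k..<b k}) \<subseteq> N" for x y a b
  proof -
    have "int_box d a b \<subseteq> cubes d N" using that(3) unfolding cubes_def by blast
    hence "connectedin T (int_box d a b)"
      unfolding T_def by (simp add: connectedin_subtopology connectedin_int_box)
    thus ?thesis using that(1,2) unfolding connected_component_of_def by blast
  qed
  have edge: "connected_component_of T (c n) (c m)" if nm: "(n, m) \<in> grid_edges d N" for n m
  proof -
    from nm obtain k where k: "k < d" "n \<in> N" "m = n(k := n k - 1)" "m \<in> N"
      unfolding grid_edges_def by blast
    show ?thesis
    proof (rule same[of _ m "\<lambda>j. n j + 1"])
      show "c n \<in> int_box d m (\<lambda>j. n j + 1)" "c m \<in> int_box d m (\<lambda>j. n j + 1)"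
        by (auto intro!: c_box simp: k(3))
      show "(\<Pi>\<^sub>E j\<in>{..<d}. {m j..<n j + 1}) \<subseteq> N"
      proof
        fix p assume p: "p \<in> (\<Pi>\<^sub>E j\<in>{..<d}. {m j..<n j + 1})"
        have p': "p j = n j" if "j < d" "j \<noteq> k" for j using PiE_mem[OF p, of j] that by (simp add: k(3))
        have "p k = n k \<or> p k = n k - 1" using PiE_mem[OF p, of k] k(1) by (simp add: k(3)) linarith
        have ext: "p \<in> extensional {..<d}" "n \<in> extensional {..<d}" "m \<in> extensional {..<d}"
          using p k(2,4) N unfolding PiE_def by blast+
        from \<open>p k = n k \<or> p k = n k - 1\<close> consider "p k = n k" | "p k = m k" by (auto simp: k(3))
        thus "p \<in> N"
        proof cases
          case 1
          have "p j = n j" if "j \<in> {..<d}" for j using p'[of j] 1 that by (cases "j = k") simp_all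
          hence "p = n" using ext by (intro extensionalityI[of p "{..<d}" n]) simp_all
          thus ?thesis using k(2) by simp
        next
          case 2
          have "p j = m j" if "j \<in> {..<d}" for j using p'[of j] 2 that by (cases "j = k") (simp_all add: k(3))
          hence "p = m" using ext by (intro extensionalityI[of p "{..<d}" m]) simp_all
          thus ?thesis using k(4) by simp
        qed
      qed
    qed
  qed
  have to0: "connected_component_of T (c n) (c n\<^sub>0)" if "n \<in> N" "c n\<^sub>0 \<in> topspace T" for n
    using conn[OF that(1)]
  proof (induction rule: converse_rtrancl_induct)
    case base
    show ?case using that(2) by (simp add: connected_component_of_refl)
  next
    case (step y z)
    have "connected_component_of T (c y) (c z)"
      using step(1) edge[of y z] edge[of z y] connected_component_of_sym[of T "c y" "c z"] by auto
    from connected_component_of_trans[OF this step(3)] show ?case .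
  qed
  show ?thesis
  proof (cases "cubes d N = {}")
    case False
    have to_c: "corner d x \<in> N \<and> connected_component_of T x (c (corner d x))" if "x \<in> cubes d N" for x
    proof -
      from that obtain a b where ab: "x \<in> int_box d a b" "(\<Pi>\<^sub>E k\<in>{..<d}. {a k..<b k}) \<subseteq> N"
        unfolding cubes_def by blast
      have "c (corner d x) \<in> int_box d a b"
        by (rule c_box) (use PiE_mem[OF corner_in_int_box[OF ab(1)]] in auto)
      thus ?thesis using same[OF ab(1) _ ab(2)] corner_in_of_cubes[OF that] by blast
    qed
    \<comment> \<open>The path from some corner either is trivial or ends with an edge at
      \<open>n\<^sub>0\<close>; both cases place the centre of this cube in the space.\<close>
    have n0: "c n\<^sub>0 \<in> topspace T"
    proof -
      from False obtain x where x: "x \<in> cubes d N" by blast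
      have "(corner d x, n\<^sub>0) \<in> (grid_edges d N \<union> (grid_edges d N)\<inverse>)\<^sup>*"
        using conn corner_in_of_cubes[OF x] by blast
      thus ?thesis
      proof (cases rule: rtranclE)
        case base
        thus ?thesis using to_c[OF x] connected_component_in_topspace by metis
      next
        case (step m)
        hence "connected_component_of T (c m) (c n\<^sub>0) \<or> connected_component_of T (c n\<^sub>0) (c m)"
          using edge[of m "n\<^sub>0"] edge[of "n\<^sub>0" m] by auto
        thus ?thesis using connected_component_in_topspace by metis
      qed
    qed
    have "connected_space T"
      unfolding connected_space_iff_connected_component
    proof (intro ballI)
      fix x y assume "x \<in> topspace T" "y \<in> topspace T"
      hence "x \<in> cubes d N" "y \<in> cubes d N" by (auto simp: T_def)
      hence "connected_component_of T x (c n\<^sub>0)" "connected_component_of T y (c n\<^sub>0)"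
        using to_c to0[OF _ n0] by (metis connected_component_of_trans)+
      thus "connected_component_of T x y"
        by (metis connected_component_of_trans connected_component_of_sym)
    qed
    thus ?thesis using cubes_subset_Rd ts by (simp add: T_def connectedin_def)
  qed simp
qed

section \<open>Measure and tilings of unions of cubes\<close>

lemma bounded_set_cubes:
  assumes "N \<subseteq> (\<Pi>\<^sub>E k\<in>{..<d}. {0..<m})" "m > 0"
  shows "bounded_set d (of_int m) (cubes d N)"
  using assms cubes_subset_box by unfold_locales (auto intro: cubes_sets)

text \<open>Both sides are the transform at frequency 0, computed in two ways.\<close>

lemma measure_cubes:
  assumes "N \<subseteq> (\<Pi>\<^sub>E k\<in>{..<d}. {0..<m})" "m > 0"
  shows "measure (Rd_borel d) (cubes d N) = card N"
proof -
  interpret bounded_set d "of_int m" "cubes d N" by (rule bounded_set_cubes[OF assms])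
  have "finite N" using assms(1) by (rule finite_subset) (auto intro: finite_PiE)
  moreover have "N \<subseteq> (\<Pi>\<^sub>E k\<in>{..<d}. UNIV)" using assms(1) by (rule order_trans) (auto intro: PiE_mono)
  ultimately have "of_real V = complex_of_real (card N)"
    unfolding ft_0[of "\<lambda>_. 0", symmetric, OF refl] by (simp add: ft_cubes)
  thus ?thesis by (simp only: of_real_eq_iff)
qed

lemma in_Rd_translate_iff:
  assumes "x \<in> Rd d" "\<Omega> \<subseteq> Rd d"
  shows "x \<in> Rd_translate d \<Omega> a \<longleftrightarrow> (\<lambda>k\<in>{..<d}. x k - a k) \<in> \<Omega>"
proof
  assume "x \<in> Rd_translate d \<Omega> a"
  then obtain y where y: "y \<in> \<Omega>" "x = (\<lambda>k\<in>{..<d}. y k + a k)"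
    unfolding Rd_translate_def by blast
  have "(\<lambda>k\<in>{..<d}. x k - a k) = y"
    using assms(2) y by (intro Rd_eqI[of _ d]) (simp_all add: subset_iff)
  thus "(\<lambda>k\<in>{..<d}. x k - a k) \<in> \<Omega>" using y(1) by simp
next
  assume "(\<lambda>k\<in>{..<d}. x k - a k) \<in> \<Omega>"
  moreover have "x = (\<lambda>i\<in>{..<d}. (\<lambda>k\<in>{..<d}. x k - a k) i + a i)"
    by (rule Rd_eqI[OF assms(1)]) simp_all
  ultimately show "x \<in> Rd_translate d \<Omega> a" unfolding Rd_translate_def
    by (rule rev_image_eqI[where x = "\<lambda>k\<in>{..<d}. x k - a k"])
qed

text \<open>Away from the faces, x lies in the translate by an integer vector s exactly when its
  corner minus s lies in N. A tiling of the integer grid thus carries over to almost every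
  point.\<close>

lemma tiles_cubes:
  assumes N: "N \<subseteq> (\<Pi>\<^sub>E k\<in>{..<d}. {0..<m})" "m > 0" "N \<noteq> {}"
    and S: "S \<subseteq> (\<Pi>\<^sub>E k\<in>{..<d}. UNIV)"
    and tile: "\<And>p. p \<in> (\<Pi>\<^sub>E k\<in>{..<d}. UNIV) \<Longrightarrow> \<exists>!s. s \<in> S \<and> (\<lambda>k\<in>{..<d}. p k - s k) \<in> N"
  shows "tiles_by_translations d (cubes d N)"
proof -
  interpret bounded_set d "of_int m" "cubes d N" by (rule bounded_set_cubes[OF N(1,2)])
  have finN: "finite N" using N(1) by (rule finite_subset) (auto intro: finite_PiE)
  define \<iota> where "\<iota> s = (\<lambda>k\<in>{..<d}. real_of_int (s k))" for s
  have "countable S"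
    using S by (rule countable_subset) (auto intro: countable_PiE)
  hence "countable (\<iota> ` S)" by simp
  moreover have "\<iota> ` S \<subseteq> Rd d"
  proof (rule image_subsetI)
    show "\<iota> s \<in> Rd d" for s unfolding \<iota>_def restrict_PiE_iff by simp
  qed
  moreover have "AE x in Rd_borel d. \<exists>!a. a \<in> \<iota> ` S \<and> x \<in> Rd_translate d (cubes d N) a"
  proof -
    have "AE x in Rd_borel d. x \<in> space (Rd_borel d)" by (rule AE_space)
    with AE_coordinates_not_Ints show ?thesis
    proof eventually_elim
      fix x assume x: "\<forall>k<d. x k \<notin> \<int>" "x \<in> space (Rd_borel d)"
      have xR: "x \<in> Rd d" using x(2) by (simp only: space_Rd_borel)
      have iff: "x \<in> Rd_translate d (cubes d N) (\<iota> s) \<longleftrightarrow> (\<lambda>k\<in>{..<d}. corner d x k - s k) \<in> N" for s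
      proof -
        have "(\<lambda>k\<in>{..<d}. x k - \<iota> s k) \<in> cubes d N \<longleftrightarrow> corner d (\<lambda>k\<in>{..<d}. x k - \<iota> s k) \<in> N"
        proof (rule in_cubes_iff)
          fix k assume "k < d"
          thus "(\<lambda>k\<in>{..<d}. x k - \<iota> s k) k \<notin> \<int>"
            using x(1) Ints_add[of "x k - real_of_int (s k)" "real_of_int (s k)"] by (auto simp: \<iota>_def)
        qed simp
        also have "corner d (\<lambda>k\<in>{..<d}. x k - \<iota> s k) = (\<lambda>k\<in>{..<d}. corner d x k - s k)"
          unfolding corner_def by (rule restrict_ext) (simp add: \<iota>_def)
        finally show ?thesis unfolding in_Rd_translate_iff[OF xR cubes_subset_Rd] .
      qed
      have "corner d x \<in> (\<Pi>\<^sub>E k\<in>{..<d}. UNIV)" by (simp add: corner_def)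
      from tile[OF this] obtain s where s: "s \<in> S \<and> (\<lambda>k\<in>{..<d}. corner d x k - s k) \<in> N"
        "\<forall>s'. s' \<in> S \<and> (\<lambda>k\<in>{..<d}. corner d x k - s' k) \<in> N \<longrightarrow> s' = s" by (rule ex1E)
      show "\<exists>!a. a \<in> \<iota> ` S \<and> x \<in> Rd_translate d (cubes d N) a"
      proof (rule ex1I[of _ "\<iota> s"])
        show "\<iota> s \<in> \<iota> ` S \<and> x \<in> Rd_translate d (cubes d N) (\<iota> s)" unfolding iff using s(1) by blast
      next
        fix a assume a: "a \<in> \<iota> ` S \<and> x \<in> Rd_translate d (cubes d N) a"
        then obtain s' where "s' \<in> S" "a = \<iota> s'" by blast
        moreover from this a have "(\<lambda>k\<in>{..<d}. corner d x k - s' k) \<in> N"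
          unfolding iff[symmetric] by blast
        ultimately show "a = \<iota> s" using s(2) by blast
      qed
    qed
  qed
  hence "AE x in Rd_lebesgue d. \<exists>!a. a \<in> \<iota> ` S \<and> x \<in> Rd_translate d (cubes d N) a"
    unfolding Rd_lebesgue_def by (rule AE_completion)
  moreover have "positive_finite_measure_set d (cubes d N)"
  proof -
    have "V > 0" using measure_cubes[OF N(1,2)] N(3) finN by (simp add: card_gt_0_iff)
    thus ?thesis using emeasure_finite
      by (simp add: positive_finite_measure_set_def Rd_lebesgue_def cubes_sets measure_def
          enn2real_positive_iff)
  qed
  ultimately show ?thesis unfolding tiles_by_translations_def by blast
qed

lemma grid_lower_coordinate:
  assumes "k < d" "0 \<le> n k" "\<And>v. 0 \<le> v \<Longrightarrow> v \<le> n k \<Longrightarrow> n(k := v) \<in> N"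
  shows "(n, n(k := 0)) \<in> (grid_edges d N)\<^sup>*"
  using assms(2,3)
proof (induction "nat (n k)" arbitrary: n)
  case 0
  hence "n(k := 0) = n" by auto
  thus ?case by simp
next
  case (Suc j)
  let ?m = "n(k := n k - 1)"
  have "n \<in> N" using Suc.prems(2)[of "n k"] Suc.prems(1) by simp
  moreover have "?m \<in> N" using Suc.hyps(2) by (intro Suc.prems(2)) auto
  ultimately have "(n, ?m) \<in> grid_edges d N" unfolding grid_edges_def using assms(1) by blast
  moreover have "(?m, ?m(k := 0)) \<in> (grid_edges d N)\<^sup>*"
  proof (rule Suc.hyps(1))
    show "?m(k := v) \<in> N" if "0 \<le> v" "v \<le> ?m k" for v
      using Suc.prems(2)[of v] that by simp
  qed (use Suc.hyps(2) in auto)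
  ultimately show ?case by simp
qed

lemma grid_lower_coordinates:
  assumes "finite K" "K \<subseteq> {..<d}" "\<And>k. k \<in> K \<Longrightarrow> 0 \<le> n k"
    and "\<And>p. (\<And>k. k \<notin> K \<Longrightarrow> p k = n k) \<Longrightarrow> (\<And>k. k \<in> K \<Longrightarrow> 0 \<le> p k \<and> p k \<le> n k) \<Longrightarrow> p \<in> N"
  shows "(n, \<lambda>k. if k \<in> K then 0 else n k) \<in> (grid_edges d N)\<^sup>*"
  using assms
proof (induction K)
  case empty
  thus ?case by simp
next
  case (insert j K)
  let ?m = "\<lambda>k. if k \<in> K then 0 else n k"
  have "(n, ?m) \<in> (grid_edges d N)\<^sup>*"
  proof (rule insert.IH)
    fix p assume p: "\<And>k. k \<notin> K \<Longrightarrow> p k = n k" "\<And>k. k \<in> K \<Longrightarrow> 0 \<le> p k \<and> p k \<le> n k"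
    show "p \<in> N"
    proof (rule insert.prems(3))
      show "0 \<le> p k \<and> p k \<le> n k" if "k \<in> insert j K" for k
        using p(2)[of k] p(1)[of k] insert.prems(2)[OF that] by (cases "k \<in> K") auto
    qed (use p(1) in auto)
  qed (use insert.prems in auto)
  also have "(?m, ?m(j := 0)) \<in> (grid_edges d N)\<^sup>*"
  proof (rule grid_lower_coordinate)
    fix v assume v: "0 \<le> v" "v \<le> ?m j"
    show "?m(j := v) \<in> N"
    proof (rule insert.prems(3))
      show "0 \<le> (?m(j := v)) k \<and> (?m(j := v)) k \<le> n k" if "k \<in> insert j K" for k
        using v insert.prems(2)[OF that] insert.hyps(2) by auto
    qed auto
  qed (use insert in auto)
  also have "?m(j := 0) = (\<lambda>k. if k \<in> insert j K then 0 else n k)" by auto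
  finally show ?case .
qed

section \<open>The layers\<close>

text \<open>The exponents of a \<open>6 \<times> 6\<close> Butson-type Hadamard matrix of cube roots of unity, without its
  constant first column. The difference of any two rows is modulo 3 a permutation of
  \<open>(0, 1, 1, 2, 2)\<close>.\<close>
definition hadamard_rows :: "int list list" where
  "hadamard_rows =
    [[0, 0, 0, 0, 0],
     [0, 1, 1, 2, 2],
     [1, 0, 2, 2, 1],
     [1, 2, 0, 1, 2],
     [2, 2, 1, 0, 1],
     [2, 1, 2, 1, 0]]"

text \<open>The value 0 at coordinate 0 hides the first entry of the points (i, e_i) of A: such a
  point pairs with row b to the exponent in column i, and the point 0 of A accounts for the omitted
  constant column.\<close>

definition hadamard_row :: "nat \<Rightarrow> nat \<Rightarrow> int" where
  "hadamard_row b k = (if 1 \<le> k \<and> k \<le> 5 then hadamard_rows ! b ! (k - 1) else 0)"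

text \<open>One permutation of \<open>1, \<dots>, 5\<close> for each of the 15 pairs of rows, congruent modulo 3 to the
  difference of these rows.\<close>
definition column_coeffs :: "int list list" where
  "column_coeffs =
    [[0, 3, 2, 5, 1, 4],
     [0, 2, 3, 1, 4, 5],
     [0, 2, 1, 3, 5, 4],
     [0, 1, 4, 2, 3, 5],
     [0, 1, 2, 4, 5, 3],
     [0, 2, 1, 5, 3, 4],
     [0, 2, 5, 1, 4, 3],
     [0, 1, 2, 3, 5, 4],
     [0, 1, 3, 2, 4, 5],
     [0, 3, 1, 2, 4, 5],
     [0, 2, 1, 4, 5, 3],
     [0, 2, 5, 3, 1, 4],
     [0, 2, 3, 5, 1, 4],
     [0, 2, 1, 4, 3, 5],
     [0, 3, 1, 2, 5, 4]]"

text \<open>Layers of even index are slabs, which connect everything; layers of odd index consist of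
  columns parallel to the direction of coordinate 0.\<close>
definition layer_coeff :: "nat \<Rightarrow> nat \<Rightarrow> int" where
  "layer_coeff l k = (if even l then (if k = 0 then 1 else 0) else column_coeffs ! (l div 2) ! k)"

definition form :: "nat \<Rightarrow> (nat \<Rightarrow> int) \<Rightarrow> int" where
  "form l n = (\<Sum>k<6. layer_coeff l k * n k)"

text \<open>The period 30 is 2 * 15, a slab before each of the 15 column layers. It is also a
  multiple of 6, so that one period serves the layers and the residues of the forms.\<close>

definition layer :: "(nat \<Rightarrow> int) \<Rightarrow> nat" where
  "layer n = nat (n 6 mod 30)"

definition corners :: "nat \<Rightarrow> int \<Rightarrow> (nat \<Rightarrow> int) set" where
  "corners d m = {n \<in> \<Pi>\<^sub>E k\<in>{..<d}. {0..<m}. 6 dvd form (layer n) n}"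

text \<open>The point (i, e_i) of A; the test for coordinate 0 comes first, so that e_0 = 0.
  Coordinate 6 is always 0, hence translation by A respects the layers.\<close>

definition tile_vector :: "int \<Rightarrow> nat \<Rightarrow> int" where
  "tile_vector i k = (if k = 0 then i else if k < 6 \<and> int k = i then 1 else 0)"

lemma layer_less: "layer n < 30"
  by (simp add: layer_def nat_less_iff)

lemma form_eq:
  "form l n = layer_coeff l 0 * n 0 + layer_coeff l 1 * n 1 + layer_coeff l 2 * n 2 + layer_coeff l 3 * n 3 +
     layer_coeff l 4 * n 4 + layer_coeff l 5 * n 5"
  unfolding form_def by (simp add: eval_nat_numeral lessThan_Suc)

lemma form_even: "even l \<Longrightarrow> form l n = n 0"
  by (simp add: form_eq layer_coeff_def)

lemma form_tile_vector:
  assumes "0 \<le> i" "i < 6"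
  shows "form l (tile_vector i) = (if even l then i else
    column_coeffs ! (l div 2) ! 0 * i + (if i = 0 then 0 else column_coeffs ! (l div 2) ! nat i))"
proof -
  from assms consider "i = 0" | "i = 1" | "i = 2" | "i = 3" | "i = 4" | "i = 5" by linarith
  thus ?thesis by cases (simp_all add: form_eq layer_coeff_def tile_vector_def)
qed

lemma column_coeffs_bij:
  "\<forall>c\<in>set column_coeffs. length c = 6 \<and> distinct c \<and> set c = {0..<6} \<and> c ! 0 = 0"
proof -
  have "{0..<6::int} = {0, 1, 2, 3, 4, 5}" by auto
  thus ?thesis by (simp add: column_coeffs_def) auto
qed

lemma length_column_coeffs: "length column_coeffs = 15"
  by (simp add: column_coeffs_def)

lemma layer_coeff_odd_0: "l < 30 \<Longrightarrow> odd l \<Longrightarrow> layer_coeff l 0 = 0"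
  using column_coeffs_bij nth_mem[of "l div 2" column_coeffs]
  by (simp add: layer_coeff_def length_column_coeffs)

text \<open>Every form maps A bijectively onto Z/6: its value at the i-th point is i in a slab layer
  and c_i in a column layer, where c is a permutation of 0, ..., 5 with c_0 = 0.\<close>

lemma ex1_tile_vector:
  assumes "l < 30"
  shows "\<exists>!i. 0 \<le> i \<and> i < 6 \<and> form l (tile_vector i) mod 6 = r mod 6"
proof (cases "even l")
  case True
  show ?thesis
  proof (rule ex1I[of _ "r mod 6"])
    fix i assume i: "0 \<le> i \<and> i < 6 \<and> form l (tile_vector i) mod 6 = r mod 6"
    hence "i mod 6 = r mod 6" using True by (simp add: form_even tile_vector_def)
    thus "i = r mod 6" using i by simp
  qed (use True in \<open>simp add: form_even tile_vector_def\<close>)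
next
  case False
  define c where "c = column_coeffs ! (l div 2)"
  have "c \<in> set column_coeffs"
    unfolding c_def using assms by (intro nth_mem) (simp add: length_column_coeffs)
  hence c: "length c = 6" "distinct c" "set c = {0..<6}" "c ! 0 = 0"
    using column_coeffs_bij by blast+
  have form: "form l (tile_vector i) = c ! nat i" if "0 \<le> i" "i < 6" for i
    using form_tile_vector[OF that, of l] False c(4) by (simp add: c_def)
  have range: "c ! k \<in> {0..<6}" if "k < 6" for k using c(1,3) that nth_mem by metis
  have "r mod 6 \<in> set c" using c(3) by simp
  then obtain k where k: "k < 6" "c ! k = r mod 6" using c(1) by (metis in_set_conv_nth)
  show ?thesis
  proof (rule ex1I[of _ "int k"])
    show "0 \<le> int k \<and> int k < 6 \<and> form l (tile_vector (int k)) mod 6 = r mod 6"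
      using k by (simp add: form)
    fix i assume i: "0 \<le> i \<and> i < 6 \<and> form l (tile_vector i) mod 6 = r mod 6"
    hence "c ! nat i mod 6 = r mod 6" using form[of i] by auto
    moreover have ni: "nat i < 6" using i by linarith
    ultimately have "c ! nat i = c ! k" using range[of "nat i"] k(2) by simp
    hence "nat i = k" using c(1,2) k(1) ni nth_eq_iff_index_eq[of c "nat i" k] by simp
    thus "i = int k" using i by linarith
  qed
qed

text \<open>There are 36 ordered pairs but 15 vectors: one congruent modulo 3 to the difference
  serves with r = 4, one congruent to its negative with r = 2, and equal rows take r = 0. The factor
  2 is why congruence modulo 3 is enough for divisibility by 6.\<close>

lemma hadamard_coeff:
  assumes "b < 6" "b' < 6"
  shows "\<exists>l<30. \<exists>r<6. \<forall>k<6. 6 dvd (int r * layer_coeff l k + 2 * (hadamard_row b' k - hadamard_row b k))"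
proof -
  have "\<forall>b\<in>set [0..<6]. \<forall>b'\<in>set [0..<6]. \<exists>l\<in>set [0..<30]. \<exists>r\<in>set [0..<6]. \<forall>k\<in>set [0..<6].
     (int r * layer_coeff l k + 2 * (hadamard_row b' k - hadamard_row b k)) mod 6 = 0" by code_simp
  from bspec[OF bspec[OF this, of b], of b'] assms obtain l r where
    "l < 30" "r < 6" "\<forall>k\<in>set [0..<6].
      (int r * layer_coeff l k + 2 * (hadamard_row b' k - hadamard_row b k)) mod 6 = 0"
    by auto
  moreover from this(3) have "\<forall>k<6. 6 dvd (int r * layer_coeff l k + 2 * (hadamard_row b' k - hadamard_row b k))"
    by (simp add: dvd_eq_mod_eq_0)
  ultimately show ?thesis by blast
qed

lemma hadamard_row_inj:
  assumes "b < 6" "b' < 6" "\<And>k. k \<in> {1..5} \<Longrightarrow> hadamard_row b k mod 3 = hadamard_row b' k mod 3"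
  shows "b = b'"
proof -
  have "\<forall>b\<in>set [0..<6]. \<forall>b'\<in>set [0..<6]. (\<forall>k\<in>set [1..<6]. hadamard_row b k mod 3 = hadamard_row b' k mod 3) \<longrightarrow> b = b'"
    by code_simp
  moreover have "\<forall>k\<in>set [1..<6]. hadamard_row b k mod 3 = hadamard_row b' k mod 3" using assms(3) by simp
  ultimately show ?thesis using assms(1,2) by simp
qed

section \<open>Tiling and connectedness of the layered set\<close>

lemma form_diff_dvd_iff:
  assumes "\<And>k. k < 6 \<Longrightarrow> 6 dvd q k - (p k - t k)"
  shows "6 dvd form l q \<longleftrightarrow> form l t mod 6 = form l p mod 6"
proof -
  have "form l q - (form l p - form l t) = (\<Sum>k<6. layer_coeff l k * (q k - (p k - t k)))"
    by (simp add: form_def sum_subtractf[symmetric] right_diff_distrib)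
  also have "6 dvd \<dots>" using assms by (intro dvd_sum) simp
  finally show ?thesis by presburger
qed

lemma layer_cong: "30 dvd n 6 - n' 6 \<Longrightarrow> layer n = layer n'"
  unfolding layer_def by (metis mod_eq_dvd_iff)

text \<open>The translations form A + m Z^d. As 30 divides m and A does not move coordinate 6, p - s
  stays in the layer of p; the form of this layer selects i, and division with remainder by m then
  selects z.\<close>

lemma corners_tile:
  assumes d: "7 \<le> d" and m: "30 dvd m" "m > 0" and p: "p \<in> (\<Pi>\<^sub>E k\<in>{..<d}. UNIV)"
  shows "\<exists>!s. s \<in> {\<lambda>k\<in>{..<d}. tile_vector i k + m * z k | i z. 0 \<le> i \<and> i < 6} \<and>
    (\<lambda>k\<in>{..<d}. p k - s k) \<in> corners d m"
proof -
  define v where "v i z = (\<lambda>k\<in>{..<d}. tile_vector i k + m * z k)" for i and z :: "nat \<Rightarrow> int"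
  have iff: "(\<lambda>k\<in>{..<d}. p k - v i z k) \<in> corners d m \<longleftrightarrow>
     (\<forall>k<d. 0 \<le> p k - tile_vector i k - m * z k \<and> p k - tile_vector i k - m * z k < m) \<and>
     form (layer p) (tile_vector i) mod 6 = form (layer p) p mod 6" for i z
  proof -
    define q where "q = (\<lambda>k\<in>{..<d}. p k - v i z k)"
    have qk: "q k = p k - tile_vector i k - m * z k" if "k < d" for k
      using that by (simp add: q_def v_def)
    have "layer q = layer p"
      by (rule layer_cong) (use d m qk[of 6] in \<open>simp add: tile_vector_def\<close>)
    moreover have "6 dvd form (layer p) q \<longleftrightarrow>
       form (layer p) (tile_vector i) mod 6 = form (layer p) p mod 6"
    proof (rule form_diff_dvd_iff)
      fix k :: nat assume "k < 6"
      moreover have "6 dvd m" using m(1) by presburger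
      ultimately show "6 dvd q k - (p k - tile_vector i k)" using d by (simp add: qk)
    qed
    moreover have "q \<in> (\<Pi>\<^sub>E k\<in>{..<d}. {0..<m}) \<longleftrightarrow>
       (\<forall>k<d. 0 \<le> p k - tile_vector i k - m * z k \<and> p k - tile_vector i k - m * z k < m)"
      unfolding q_def restrict_PiE_iff by (simp add: v_def diff_diff_eq Ball_def)
    ultimately show ?thesis unfolding q_def[symmetric] by (simp add: corners_def)
  qed
  obtain i\<^sub>0 where i0: "0 \<le> i\<^sub>0 \<and> i\<^sub>0 < 6 \<and> form (layer p) (tile_vector i\<^sub>0) mod 6 = form (layer p) p mod 6"
    "\<forall>i. 0 \<le> i \<and> i < 6 \<and> form (layer p) (tile_vector i) mod 6 = form (layer p) p mod 6 \<longrightarrow> i = i\<^sub>0"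
    using ex1_tile_vector[OF layer_less] by (rule ex1E)
  define z\<^sub>0 where "z\<^sub>0 k = (p k - tile_vector i\<^sub>0 k) div m" for k
  show ?thesis unfolding v_def[symmetric]
  proof (rule ex1I[of _ "v i\<^sub>0 z\<^sub>0"], intro conjI)
    show "v i\<^sub>0 z\<^sub>0 \<in> {v i z | i z. 0 \<le> i \<and> i < 6}" using i0(1) by blast
    have "x - m * (x div m) = x mod m" for x by (simp add: minus_mult_div_eq_mod)
    thus "(\<lambda>k\<in>{..<d}. p k - v i\<^sub>0 z\<^sub>0 k) \<in> corners d m"
      unfolding iff z\<^sub>0_def using i0(1) m(2) by simp
  next
    fix s assume s: "s \<in> {v i z | i z. 0 \<le> i \<and> i < 6} \<and> (\<lambda>k\<in>{..<d}. p k - s k) \<in> corners d m"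
    then obtain i z where iz: "s = v i z" "0 \<le> i \<and> i < 6" by blast
    have c: "\<forall>k<d. 0 \<le> p k - tile_vector i k - m * z k \<and> p k - tile_vector i k - m * z k < m"
      "form (layer p) (tile_vector i) mod 6 = form (layer p) p mod 6"
      using conjunct2[OF s] unfolding iz(1) iff by blast+
    have i: "i = i\<^sub>0" using i0(2) iz(2) c(2) by blast
    have "z k = z\<^sub>0 k" if "k < d" for k
    proof -
      define x where "x = p k - tile_vector i k"
      have "0 \<le> x - m * z k" "x - m * z k < m" using c(1) that by (simp_all add: x_def)
      hence "x div m = z k" by (intro int_div_pos_eq[of _ _ _ "x - m * z k"]) auto
      thus ?thesis by (simp add: z\<^sub>0_def x_def i)
    qed
    thus "s = v i\<^sub>0 z\<^sub>0" unfolding iz(1) v_def i by (intro restrict_ext) simp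
  qed
qed

text \<open>No layer is connected by itself: a slab layer has gaps between n_0 = 0, 6, 12, ..., and
  a column layer has gaps between its columns. Each kind bridges the gaps of the other, so a path to
  the origin has to change layers.\<close>

lemma corners_connected:
  assumes d: "7 \<le> d" and m: "30 dvd m" and n: "n \<in> corners d m"
  shows "(n, \<lambda>k\<in>{..<d}. 0) \<in> (grid_edges d (corners d m) \<union> (grid_edges d (corners d m))\<inverse>)\<^sup>*"
proof -
  let ?N = "corners d m" and ?E = "grid_edges d (corners d m)"
  have N_iff: "n \<in> ?N \<longleftrightarrow> n \<in> extensional {..<d} \<and> (\<forall>k<d. 0 \<le> n k \<and> n k < m) \<and> 6 dvd form (layer n) n" for n
    unfolding corners_def by (auto simp: PiE_def Pi_def)
  have layer_even: "even (layer n) \<longleftrightarrow> even (n 6)" for n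
  proof -
    have "int (layer n) = n 6 mod 30" by (simp add: layer_def)
    thus ?thesis by presburger
  qed
  have lower: "(n, \<lambda>k. if k \<in> K then 0 else n k) \<in> ?E\<^sup>*"
    if nN: "n \<in> ?N" and K: "K \<subseteq> {..<d}" and form: "\<And>p. (\<And>k. k \<notin> K \<Longrightarrow> p k = n k) \<Longrightarrow> 6 dvd form (layer p) p" for n K
  proof (rule grid_lower_coordinates)
    show "finite K" using K by (rule finite_subset) simp
    show "0 \<le> n k" if "k \<in> K" for k using that K nN by (auto simp: N_iff)
    fix p assume p: "\<And>k. k \<notin> K \<Longrightarrow> p k = n k" "\<And>k. k \<in> K \<Longrightarrow> 0 \<le> p k \<and> p k \<le> n k"
    have "p \<in> extensional {..<d}"
    proof (unfold extensional_def, intro CollectI allI impI)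
      fix k assume "k \<notin> {..<d}"
      thus "p k = undefined" using K nN p(1)[of k] unfolding N_iff by (auto simp: extensional_def)
    qed
    moreover have "0 \<le> p k \<and> p k < m" if "k < d" for k
    proof (cases "k \<in> K")
      case True
      have "n k < m" using nN that unfolding N_iff by blast
      thus ?thesis using p(2)[OF True] by linarith
    next
      case False
      thus ?thesis using nN that unfolding N_iff by (simp add: p(1))
    qed
    ultimately show "p \<in> ?N" unfolding N_iff using form[OF p(1)] by blast
  qed (rule K)
  have "0 < m" using n d unfolding N_iff by fastforce
  have slab: "(n, \<lambda>k\<in>{..<d}. 0) \<in> (?E \<union> ?E\<inverse>)\<^sup>*" if n: "n \<in> ?N" "even (n 6)" for n
  proof -
    define K where "K = {1..5} \<union> {7..<d}"
    have n0: "6 dvd n 0" using n layer_even[of n] by (simp add: N_iff form_even)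
    define n3 where "n3 = (\<lambda>k. if k \<in> K then 0 else n k)"
    have s1: "(n, n3) \<in> ?E\<^sup>*" unfolding n3_def
    proof (rule lower[OF n(1)])
      show "K \<subseteq> {..<d}" using d by (auto simp: K_def)
      fix p assume "\<And>k. k \<notin> K \<Longrightarrow> p k = n k"
      from this[of 0] this[of 6] show "6 dvd form (layer p) p"
        using n0 n(2) layer_even[of p] by (simp add: K_def form_even)
    qed
    \<comment> \<open>One step up leads to a column layer. Coordinates 1 to 5 are 0 there, so the
      form vanishes for every n_0, and n_0 can descend to 0 across the gaps between the
      slabs.\<close>
    define n4 where "n4 = n3(6 := n3 6 + 1)"
    have n3N: "n3 \<in> ?N"
      using n d n0 layer_even[of n3] \<open>0 < m\<close> unfolding N_iff by (auto simp: n3_def K_def form_even extensional_def)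
    have n4N: "n4 \<in> ?N"
    proof -
      have "n 6 < m" using n d unfolding N_iff by simp
      \<comment> \<open>Both n_6 and m are even, so a slab layer is never the top one and has a
        column layer above it inside the box.\<close>
      moreover have "n 6 + 1 \<noteq> m" using n(2) m by presburger
      ultimately have "n 6 + 1 < m" by linarith
      moreover have "form l n4 = layer_coeff l 0 * n 0" for l
        by (simp add: form_eq n4_def n3_def K_def)
      ultimately show ?thesis using n3N n0 n d unfolding N_iff
        by (auto simp: n4_def n3_def K_def extensional_def)
    qed
    have "(n4, n3) \<in> ?E" unfolding grid_edges_def
      using n3N n4N d by (intro CollectI exI[of _ n4] exI[of _ 6]) (auto simp: n4_def)
    hence s2: "(n3, n4) \<in> (?E \<union> ?E\<inverse>)\<^sup>*" by blast
    define n5 where "n5 = (\<lambda>k. if k \<in> {0} then 0 else n4 k)"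
    have odd4: "odd (n4 6)" using n(2) by (simp add: n4_def n3_def K_def)
    have s3: "(n4, n5) \<in> ?E\<^sup>*" unfolding n5_def
    proof (rule lower[OF n4N])
      fix p assume p: "\<And>k. k \<notin> {0::nat} \<Longrightarrow> p k = n4 k"
      have "odd (layer p)" using layer_even[of p] p[of 6] odd4 by simp
      thus "6 dvd form (layer p) p"
        using p by (simp add: form_eq layer_coeff_odd_0[OF layer_less] n4_def n3_def K_def)
    qed (use d in auto)
    \<comment> \<open>Once coordinates 0 to 5 are 0, every form vanishes, and coordinate 6 can
      descend through all layers.\<close>
    have form5: "form l p = 0" if "\<And>k. k \<notin> {6::nat} \<Longrightarrow> p k = n5 k" for p l
      using that by (simp add: form_eq n5_def n4_def n3_def K_def)
    have n5N: "n5 \<in> ?N" using n4N d form5[of n5] \<open>0 < m\<close> unfolding N_iff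
      by (auto simp: n5_def extensional_def)
    have s4: "(n5, \<lambda>k. if k \<in> {6} then 0 else n5 k) \<in> ?E\<^sup>*"
      by (rule lower[OF n5N]) (use d form5 in auto)
    have "(\<lambda>k. if k \<in> {6} then 0 else n5 k) = (\<lambda>k\<in>{..<d}. 0)"
    proof (rule extensionalityI[where A = "{..<d}"])
      show "(\<lambda>k. if k \<in> {6} then 0 else n5 k) \<in> extensional {..<d}"
        using n5N d unfolding N_iff by (auto simp: extensional_def)
      fix k assume "k \<in> {..<d}"
      thus "(if k \<in> {6} then 0 else n5 k) = (\<lambda>k\<in>{..<d}. 0) k"
        by (simp add: n5_def n4_def n3_def K_def)
    qed simp
    with s4 have s4: "(n5, \<lambda>k\<in>{..<d}. 0) \<in> ?E\<^sup>*" by simp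
    have mono: "?E\<^sup>* \<subseteq> (?E \<union> ?E\<inverse>)\<^sup>*" by (rule rtrancl_mono) blast
    from s1 s3 s4 mono s2 show ?thesis by (meson rtrancl_trans subsetD)
  qed
  show ?thesis
  proof (cases "even (n 6)")
    case True
    thus ?thesis using slab n by blast
  next
    case False
    \<comment> \<open>In a column layer n_0 does not enter the form. With n_0 = 0 the cube lies next
      to one of the slab layer below, which brings back the even case.\<close>
    define n1 where "n1 = (\<lambda>k. if k \<in> {0} then 0 else n k)"
    have formp: "6 dvd form (layer p) p" if p: "\<And>k. k \<notin> {0::nat} \<Longrightarrow> p k = n k" for p
    proof -
      have "layer p = layer n" using p[of 6] by (intro layer_cong) simp
      moreover have "odd (layer n)" using layer_even[of n] False by simp
      hence "form (layer n) p = form (layer n) n"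
        using p by (simp add: form_eq layer_coeff_odd_0[OF layer_less])
      ultimately show ?thesis using n unfolding N_iff by simp
    qed
    have s1: "(n, n1) \<in> ?E\<^sup>*" unfolding n1_def
      by (rule lower[OF n]) (use d formp in auto)
    have n1N: "n1 \<in> ?N" using n d formp[of n1] \<open>0 < m\<close> unfolding N_iff by (auto simp: n1_def extensional_def)
    define n2 where "n2 = n1(6 := n1 6 - 1)"
    have e2: "even (n2 6)" using False by (simp add: n2_def n1_def)
    have "0 \<le> n 6" "n 6 < m" using n d unfolding N_iff by simp_all
    moreover from this have "1 \<le> n 6" using False by (cases "n 6 = 0") auto
    ultimately have n2N: "n2 \<in> ?N" using n1N d e2 layer_even[of n2] unfolding N_iff
      by (auto simp: n2_def n1_def extensional_def form_even)
    have "(n1, n2) \<in> ?E" unfolding grid_edges_def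
      using n1N n2N d by (intro CollectI exI[of _ n1] exI[of _ 6]) (auto simp: n2_def)
    moreover have "?E\<^sup>* \<subseteq> (?E \<union> ?E\<inverse>)\<^sup>*" by (rule rtrancl_mono) blast
    ultimately have "(n, n2) \<in> (?E \<union> ?E\<inverse>)\<^sup>*" using s1 by (meson UnI1 rtrancl.rtrancl_into_rtrancl subsetD)
    thus ?thesis using slab[OF n2N e2] by (rule rtrancl_trans)
  qed
qed

section \<open>The Fourier transform of the layers\<close>

definition corner_sum :: "nat \<Rightarrow> int \<Rightarrow> (nat \<Rightarrow> real) \<Rightarrow> complex" where
  "corner_sum d m \<xi> = (\<Sum>n\<in>corners d m. \<Prod>k<d. ex (\<xi> k * of_int (n k)))"

lemma corners_subset: "corners d m \<subseteq> (\<Pi>\<^sub>E k\<in>{..<d}. {0..<m})"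
  by (auto simp: corners_def)

lemma finite_corners: "finite (corners d m)"
  by (rule finite_subset[OF corners_subset]) (auto intro: finite_PiE)

lemma sum_ex_int: "0 \<le> m \<Longrightarrow> (\<Sum>x\<in>{0..<m}. ex (t * of_int x)) = (\<Sum>j<nat m. ex t ^ j)"
proof -
  assume m: "0 \<le> m"
  have "{0..<m} = int ` {..<nat m}"
    using m by (simp add: image_int_atLeastLessThan lessThan_atLeast0)
  hence "(\<Sum>x\<in>{0..<m}. ex (t * of_int x)) = (\<Sum>j<nat m. ex (of_nat j * t))"
    by (simp add: sum.reindex mult.commute)
  thus ?thesis by (simp only: ex_of_nat_mult)
qed

lemma sum_ex_period:
  assumes "0 < m" "t * of_int m \<in> \<int>"
  shows "(\<Sum>x\<in>{0..<m}. ex (t * of_int x)) = (if t \<in> \<int> then of_int m else 0)"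
proof (cases "t \<in> \<int>")
  case True
  hence "ex t = 1" by (simp add: ex_eq_1_iff)
  thus ?thesis using True assms(1) by (subst sum_ex_int) auto
next
  case False
  hence "ex t \<noteq> 1" by (simp add: ex_eq_1_iff)
  moreover have "ex t ^ nat m = 1"
    using assms by (simp add: ex_of_nat_mult[symmetric] ex_eq_1_iff mult.commute)
  ultimately show ?thesis using False assms(1)
    by (subst sum_ex_int) (auto simp: sum_gp_strict)
qed

text \<open>A geometric sum of m terms has its first zeros at |t| = 1 / m. This fixes the width of
  the windows in the density argument.\<close>

lemma sum_ex_nonzero:
  assumes "0 < m" "\<bar>t\<bar> * of_int m < 1"
  shows "(\<Sum>x\<in>{0..<m}. ex (t * of_int x)) \<noteq> 0"
proof (cases "t = 0")
  case True
  thus ?thesis using assms by simp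
next
  case False
  have Ints: "s \<notin> \<int>" if "s \<noteq> 0" "\<bar>s\<bar> < 1" for s :: real using that by (auto elim!: Ints_cases)
  have "\<bar>t\<bar> * 1 \<le> \<bar>t\<bar> * of_int m" using assms(1) by (intro mult_left_mono) auto
  hence "\<bar>t\<bar> < 1" using assms(2) by linarith
  hence "ex t \<noteq> 1" using Ints[of t] False by (simp add: ex_eq_1_iff)
  moreover have "ex t ^ nat m \<noteq> 1"
  proof -
    have "t * of_int m \<notin> \<int>"
      using assms False by (intro Ints) (simp_all add: abs_mult)
    moreover have "ex t ^ nat m = ex (t * of_int m)"
      using assms(1) by (simp add: ex_of_nat_mult[symmetric] mult.commute)
    ultimately show ?thesis by (simp only: ex_eq_1_iff) simp
  qed
  ultimately show ?thesis using assms(1) by (subst sum_ex_int) (auto simp: sum_gp_strict)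
qed

text \<open>\<open>corners d (30 * N)\<close> is the sum of \<open>corners d 30\<close> and an \<open>N \<times> \<dots> \<times> N\<close> grid.\<close>

lemma corner_sum_factor:
  assumes d: "7 \<le> d" and N: "0 < N" and per: "\<And>k. k < d \<Longrightarrow> 30 * (\<xi> k - \<theta> k) \<in> \<int>"
  shows "corner_sum d (30 * N) \<xi> =
    corner_sum d 30 \<xi> * (\<Prod>k<d. \<Sum>x\<in>{0..<N}. ex (30 * \<theta> k * of_int x))"
proof -
  let ?G = "\<Pi>\<^sub>E k\<in>{..<d}. {0..<N}"
  let ?c = "\<lambda>(n, g). \<lambda>k\<in>{..<d}. n k + 30 * g k :: int"
  have cong: "6 dvd form (layer q) q \<longleftrightarrow> 6 dvd form (layer n) n"
    if "\<And>k. k < d \<Longrightarrow> q k = n k + 30 * g k" for q n g :: "nat \<Rightarrow> int"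
  proof -
    have a: "layer q = layer n" using that[of 6] d by (intro layer_cong) simp
    have b: "6 dvd form (layer n) q \<longleftrightarrow>
      form (layer n) (\<lambda>_. 0) mod 6 = form (layer n) n mod 6"
    proof (rule form_diff_dvd_iff)
      fix k :: nat assume "k < 6"
      hence "q k - (n k - 0) = 6 * (5 * g k)" using that[of k] d by simp
      thus "6 dvd q k - (n k - 0)" by (metis dvd_triv_left)
    qed
    have c: "form (layer n) (\<lambda>_. 0) = 0" by (simp add: form_def)
    show ?thesis unfolding a b c by presburger
  qed
  have "corner_sum d (30 * N) \<xi> =
    (\<Sum>p\<in>corners d 30 \<times> ?G. \<Prod>k<d. ex (\<xi> k * of_int (?c p k)))"
    unfolding corner_sum_def
  proof (rule sum.reindex_bij_witness[of _ ?c
        "\<lambda>q. (\<lambda>k\<in>{..<d}. q k mod 30, \<lambda>k\<in>{..<d}. q k div 30)"])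
    fix q assume q: "q \<in> corners d (30 * N)"
    have qk: "0 \<le> q k \<and> q k < 30 * N" if "k < d" for k
      using q that corners_subset by (fastforce simp: PiE_iff)
    have qe: "q \<in> extensional {..<d}" using q corners_subset by (fastforce simp: PiE_iff)
    show "?c (\<lambda>k\<in>{..<d}. q k mod 30, \<lambda>k\<in>{..<d}. q k div 30) = q"
      by (rule extensionalityI[OF _ qe]) auto
    have "6 dvd form (layer q) q \<longleftrightarrow>
      6 dvd form (layer (\<lambda>k\<in>{..<d}. q k mod 30)) (\<lambda>k\<in>{..<d}. q k mod 30)"
      by (rule cong[where g = "\<lambda>k. q k div 30"]) simp
    hence "(\<lambda>k\<in>{..<d}. q k mod 30) \<in> corners d 30"
      using q by (simp add: corners_def)
    moreover have "q k div 30 < N \<and> 0 \<le> q k div 30" if "k < d" for k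
      using qk[OF that] by linarith
    ultimately show "(\<lambda>k\<in>{..<d}. q k mod 30, \<lambda>k\<in>{..<d}. q k div 30) \<in> corners d 30 \<times> ?G"
      by simp
    show "(\<Prod>k<d. ex (\<xi> k * of_int (?c (\<lambda>k\<in>{..<d}. q k mod 30, \<lambda>k\<in>{..<d}. q k div 30) k))) =
      (\<Prod>k<d. ex (\<xi> k * of_int (q k)))" by (intro prod.cong) auto
  next
    fix p assume "p \<in> corners d 30 \<times> ?G"
    then obtain n g where p: "p = (n, g)" "n \<in> corners d 30" "g \<in> ?G" by blast
    have nk: "0 \<le> n k \<and> n k < 30" if "k < d" for k
      using p(2) that corners_subset by (fastforce simp: PiE_iff)
    have gk: "0 \<le> g k \<and> g k < N" if "k < d" for k
      using p(3) that by (simp add: PiE_iff)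
    have ne: "n \<in> extensional {..<d}" using p(2) corners_subset by (fastforce simp: PiE_iff)
    have ge: "g \<in> extensional {..<d}" using p(3) by (simp add: PiE_iff)
    have "(\<lambda>k\<in>{..<d}. ?c p k mod 30) = n"
      by (rule extensionalityI[OF _ ne]) (use nk in \<open>simp_all add: p(1)\<close>)
    moreover have "(\<lambda>k\<in>{..<d}. ?c p k div 30) = g"
      by (rule extensionalityI[OF _ ge]) (use nk in \<open>simp_all add: p(1)\<close>)
    ultimately show "(\<lambda>k\<in>{..<d}. ?c p k mod 30, \<lambda>k\<in>{..<d}. ?c p k div 30) = p"
      by (simp only: p(1))
    have "6 dvd form (layer (?c p)) (?c p) \<longleftrightarrow> 6 dvd form (layer n) n"
      by (rule cong[where g = g]) (simp add: p(1))
    moreover have "0 \<le> n k + 30 * g k \<and> n k + 30 * g k < 30 * N" if "k < d" for k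
      using nk[OF that] gk[OF that] by linarith
    ultimately show "?c p \<in> corners d (30 * N)"
      using p(2) by (simp add: corners_def p(1))
  qed
  also have "\<dots> = (\<Sum>p\<in>corners d 30 \<times> ?G. (\<Prod>k<d. ex (\<xi> k * of_int (fst p k))) *
      (\<Prod>k<d. ex (30 * \<theta> k * of_int (snd p k))))"
  proof (rule sum.cong[OF refl])
    fix p assume "p \<in> corners d 30 \<times> ?G"
    obtain n g where p: "p = (n, g)" by (cases p)
    \<comment> \<open>On multiples of 30 the frequencies \<xi> and \<theta> have the same phase, so
      the grid of periods sees only the small deviation \<theta>.\<close>
    have "ex (\<xi> k * of_int (n k + 30 * g k)) = ex (\<xi> k * of_int (n k)) * ex (30 * \<theta> k * of_int (g k))"
      if "k < d" for k
    proof -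
      have "\<xi> k * of_int (n k + 30 * g k) =
        \<xi> k * of_int (n k) + 30 * \<theta> k * of_int (g k) + 30 * (\<xi> k - \<theta> k) * of_int (g k)"
        by (simp add: algebra_simps)
      moreover have "ex (30 * (\<xi> k - \<theta> k) * of_int (g k)) = 1"
        unfolding ex_eq_1_iff by (intro Ints_mult per that) auto
      ultimately show ?thesis by (simp add: ex_add)
    qed
    thus "(\<Prod>k<d. ex (\<xi> k * of_int (?c p k))) = (\<Prod>k<d. ex (\<xi> k * of_int (fst p k))) *
      (\<Prod>k<d. ex (30 * \<theta> k * of_int (snd p k)))"
      by (simp add: p prod.distrib[symmetric])
  qed
  also have "\<dots> = corner_sum d 30 \<xi> * (\<Sum>g\<in>?G. \<Prod>k<d. ex (30 * \<theta> k * of_int (g k)))"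
    unfolding corner_sum_def sum_product sum.cartesian_product by (simp add: case_prod_beta)
  also have "(\<Sum>g\<in>?G. \<Prod>k<d. ex (30 * \<theta> k * of_int (g k))) =
    (\<Prod>k<d. \<Sum>x\<in>{0..<N}. ex (30 * \<theta> k * of_int x))"
    by (rule prod_sum_PiE[symmetric]) auto
  finally show ?thesis .
qed

text \<open>The sum over n_k in {0..<30} contributed by coordinate k in layer l under the r-th
  character of Z/6: full periods for k < 6, the single term fixed by the layer for k = 6, and 30
  terms equal to 1 beyond.\<close>

definition orbit_factor :: "(nat \<Rightarrow> int) \<Rightarrow> nat \<Rightarrow> nat \<Rightarrow> nat \<Rightarrow> real" where
  "orbit_factor g r l k =
    (if k < 6 then if 6 dvd int r * layer_coeff l k + 2 * g k then 30 else 0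
     else if k = 6 then 1 else 30)"

lemma sixth_in_Ints_iff: "real_of_int z / 6 \<in> \<int> \<longleftrightarrow> 6 dvd z"
proof
  assume "real_of_int z / 6 \<in> \<int>"
  then obtain j where "real_of_int z / 6 = of_int j" by (elim Ints_cases)
  hence "real_of_int z = of_int (6 * j)" by simp
  hence "z = 6 * j" by (simp only: of_int_eq_iff)
  thus "6 dvd z" by simp
qed (auto elim!: dvdE)

lemma six_dvd_indicator:
  "(\<Sum>r<6. ex (of_nat r * of_int z / 6)) = (if 6 dvd z then 6 else 0)"
proof -
  have "(\<Sum>r<6. ex (of_nat r * of_int z / 6)) = (\<Sum>x\<in>{0..<6}. ex (of_int z / 6 * of_int x))"
    by (subst sum_ex_int) (simp_all add: ex_of_nat_mult[symmetric])
  also have "\<dots> = (if real_of_int z / 6 \<in> \<int> then of_int 6 else 0)"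
    by (rule sum_ex_period) auto
  finally show ?thesis by (simp add: sixth_in_Ints_iff)
qed

text \<open>Divisibility by 6 is the average of the six characters of Z/6; each of them, restricted
  to one layer, is a product over the coordinates. The frequency is 0 in coordinate 6, so the layers
  carry no relative phase: all terms are non-negative and one positive term suffices.\<close>

lemma corner_sum_30:
  assumes d: "7 \<le> d" and g: "\<And>k. 6 \<le> k \<Longrightarrow> g k = 0"
  shows "corner_sum d 30 (\<lambda>k. of_int (g k) / 3) =
    of_real ((\<Sum>r<6. \<Sum>l<30. \<Prod>k<d. orbit_factor g r l k) / 6)"
proof -
  let ?B = "\<Pi>\<^sub>E k\<in>{..<d}. {0..<30 :: int}"
  define e where "e n = (\<Prod>k<d. ex (of_int (g k) / 3 * of_int (n k)))" for n :: "nat \<Rightarrow> int"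
  define f where "f r l k x = (if k < 6 then ex (of_int (int r * layer_coeff l k + 2 * g k) / 6 * of_int x)
     else if k = 6 then (if x = int l then 1 else 0) else 1)" for r l k and x :: int
  have finB: "finite ?B" by (intro finite_PiE) auto
  have prod_f: "(\<Prod>k<d. f r l k (n k)) =
      (if layer n = l then ex (of_nat r * of_int (form l n) / 6) * e n else 0)"
    if n: "n \<in> ?B" and l: "l < 30" for r l n
  proof -
    have "0 \<le> n 6 \<and> n 6 < 30" using n d by (simp add: PiE_iff)
    hence lay: "layer n = l \<longleftrightarrow> n 6 = int l" using l by (auto simp: layer_def)
    have split: "{..<d} = {..<6} \<union> {6} \<union> {7..<d}" using d by auto
    have P: "(\<Prod>k<d. h k) = (\<Prod>k<6. h k) * h 6 * (\<Prod>k\<in>{7..<d}. h k)" for h :: "nat \<Rightarrow> complex"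
      unfolding split by (subst prod.union_disjoint, auto)+
    have "(\<Prod>k<d. f r l k (n k)) =
      (\<Prod>k<6. ex (of_int (int r * layer_coeff l k + 2 * g k) / 6 * of_int (n k))) *
      (if n 6 = int l then 1 else 0)"
      unfolding P by (simp add: f_def)
    also have "(\<Prod>k<6. ex (of_int (int r * layer_coeff l k + 2 * g k) / 6 * of_int (n k))) =
      (\<Prod>k<6. ex (of_nat r * of_int (layer_coeff l k * n k) / 6)) *
      (\<Prod>k<6. ex (of_int (g k) / 3 * of_int (n k)))"
      unfolding prod.distrib[symmetric] ex_add[symmetric]
      by (intro prod.cong refl arg_cong[where f = ex]) (simp add: field_simps)
    also have "(\<Prod>k<6. ex (of_nat r * of_int (layer_coeff l k * n k) / 6)) =
      ex (of_nat r * of_int (form l n) / 6)"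
      unfolding form_def by (simp add: ex_sum[symmetric] sum_distrib_left sum_divide_distrib)
    also have "(\<Prod>k<6. ex (of_int (g k) / 3 * of_int (n k))) = e n"
      unfolding e_def P using g by simp
    finally show ?thesis by (simp add: lay)
  qed
  have fsum: "(\<Sum>x\<in>{0..<30}. f r l k x) = of_real (orbit_factor g r l k)" if "l < 30" for r l k
  proof -
    have "(\<Sum>x\<in>{0..<30}. ex (of_int (int r * layer_coeff l k + 2 * g k) / 6 * of_int x)) =
      (if 6 dvd int r * layer_coeff l k + 2 * g k then 30 else 0)"
    proof (subst sum_ex_period)
      show "real_of_int (int r * layer_coeff l k + 2 * g k) / 6 * of_int 30 \<in> \<int>"
      proof -
        have "real_of_int z / 6 * of_int 30 = of_int (5 * z)" for z by simp
        thus ?thesis by (metis Ints_of_int)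
      qed
    qed (simp_all only: sixth_in_Ints_iff, simp_all)
    thus ?thesis using that by (simp add: f_def orbit_factor_def)
  qed
  have "corner_sum d 30 (\<lambda>k. of_int (g k) / 3) = (\<Sum>n\<in>?B. if 6 dvd form (layer n) n then e n else 0)"
    unfolding corner_sum_def corners_def e_def[symmetric] using finB
    by (simp add: sum.inter_filter)
  also have "\<dots> = (\<Sum>n\<in>?B. (\<Sum>r<6. ex (of_nat r * of_int (form (layer n) n) / 6)) * e n / 6)"
    unfolding six_dvd_indicator by (intro sum.cong) auto
  also have "\<dots> = (\<Sum>n\<in>?B. (\<Sum>r<6. \<Sum>l<30. \<Prod>k<d. f r l k (n k)) / 6)"
  proof (intro sum.cong refl arg_cong[where f = "\<lambda>z. z / 6"])
    fix n assume n: "n \<in> ?B"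
    have "(\<Sum>l<30. \<Prod>k<d. f r l k (n k)) = ex (of_nat r * of_int (form (layer n) n) / 6) * e n" for r
    proof -
      have "(\<Sum>l<30. \<Prod>k<d. f r l k (n k)) =
        (\<Sum>l<30. if layer n = l then ex (of_nat r * of_int (form l n) / 6) * e n else 0)"
        by (intro sum.cong refl prod_f n) simp
      thus ?thesis using layer_less[of n] by simp
    qed
    thus "(\<Sum>r<6. ex (of_nat r * of_int (form (layer n) n) / 6)) * e n =
      (\<Sum>r<6. \<Sum>l<30. \<Prod>k<d. f r l k (n k))" by (simp add: sum_distrib_right)
  qed
  also have "\<dots> = (\<Sum>r<6. \<Sum>l<30. \<Sum>n\<in>?B. \<Prod>k<d. f r l k (n k)) / 6"
    unfolding sum_divide_distrib[symmetric]
    by (subst sum.swap, rule arg_cong[where f = "\<lambda>z. z / 6"], intro sum.cong refl, rule sum.swap)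
  also have "(\<Sum>r<6. \<Sum>l<30. \<Sum>n\<in>?B. \<Prod>k<d. f r l k (n k)) =
    (\<Sum>r<6. \<Sum>l<30. \<Prod>k<d. of_real (orbit_factor g r l k))"
  proof (intro sum.cong refl)
    fix r l :: nat assume "l \<in> {..<30}"
    have "(\<Sum>n\<in>?B. \<Prod>k<d. f r l k (n k)) = (\<Prod>k<d. \<Sum>x\<in>{0..<30}. f r l k x)"
      by (rule prod_sum_PiE[symmetric]) auto
    thus "(\<Sum>n\<in>?B. \<Prod>k<d. f r l k (n k)) = (\<Prod>k<d. of_real (orbit_factor g r l k))"
      using \<open>l \<in> {..<30}\<close> by (simp add: fsum)
  qed
  finally show ?thesis by simp
qed

lemma orbit_factor_nonneg: "0 \<le> orbit_factor g r l k"
  by (simp add: orbit_factor_def)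

lemma sum_orbit_factor_ge:
  assumes "r < 6" "L \<subseteq> {..<30}"
  shows "(\<Sum>l\<in>L. \<Prod>k<d. orbit_factor g r l k) \<le> (\<Sum>r<6. \<Sum>l<30. \<Prod>k<d. orbit_factor g r l k)"
proof -
  have nn: "0 \<le> (\<Prod>k<d. orbit_factor g r l k)" for r l by (intro prod_nonneg ballI orbit_factor_nonneg)
  have "(\<Sum>l\<in>L. \<Prod>k<d. orbit_factor g r l k) \<le> (\<Sum>l<30. \<Prod>k<d. orbit_factor g r l k)"
    by (rule sum_mono2) (use assms nn in auto)
  also have "\<dots> \<le> (\<Sum>r<6. \<Sum>l<30. \<Prod>k<d. orbit_factor g r l k)"
    by (rule member_le_sum[of r]) (use assms nn in \<open>auto intro: sum_nonneg\<close>)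
  finally show ?thesis .
qed

text \<open>At frequency 0 the trivial character r = 0 alone contributes 30^(d-1) for each of the 30
  layers, to be divided by 6.\<close>

lemma card_corners_30: "7 \<le> d \<Longrightarrow> 30 ^ d / 6 \<le> real (card (corners d 30))"
proof -
  assume d: "7 \<le> d"
  have "complex_of_real (card (corners d 30)) = corner_sum d 30 (\<lambda>k. of_int 0 / 3)"
    by (simp add: corner_sum_def)
  also have "\<dots> = of_real ((\<Sum>r<6. \<Sum>l<30. \<Prod>k<d. orbit_factor (\<lambda>_. 0) r l k) / 6)"
    by (rule corner_sum_30[OF d]) simp
  finally have "real (card (corners d 30)) = (\<Sum>r<6. \<Sum>l<30. \<Prod>k<d. orbit_factor (\<lambda>_. 0) r l k) / 6"
    by (simp only: of_real_eq_iff)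
  moreover have "(\<Sum>l\<in>{..<30}. \<Prod>k<d. orbit_factor (\<lambda>_. 0) 0 l k) \<le>
      (\<Sum>r<6. \<Sum>l<30. \<Prod>k<d. orbit_factor (\<lambda>_. 0) r l k)"
    by (rule sum_orbit_factor_ge) auto
  moreover have "(\<Prod>k<d. orbit_factor (\<lambda>_. 0) 0 l k) = 30 ^ (d - 1)" for l
  proof -
    have "(\<Prod>k<d. orbit_factor (\<lambda>_. 0) 0 l k) =
      orbit_factor (\<lambda>_. 0) 0 l 6 * (\<Prod>k\<in>{..<d} - {6}. orbit_factor (\<lambda>_. 0) 0 l k)"
      using d by (intro prod.remove) auto
    also have "(\<Prod>k\<in>{..<d} - {6}. orbit_factor (\<lambda>_. 0) 0 l k) = (\<Prod>k\<in>{..<d} - {6}. 30)"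
      by (intro prod.cong) (auto simp: orbit_factor_def)
    finally show ?thesis using d by (simp add: orbit_factor_def)
  qed
  moreover have "(30::real) * 30 ^ (d - 1) = 30 ^ d" using d by (cases d) auto
  ultimately show ?thesis by simp
qed

text \<open>For the layer and character of \<open>hadamard_coeff\<close> every factor is 1 or 30,
  and that of coordinate 0 is 30; the sum is therefore at least 30 / 6.\<close>

lemma corner_sum_30_ge_1:
  assumes d: "7 \<le> d" and g: "\<And>k. 6 \<le> k \<Longrightarrow> g k = 0"
    and b: "b < 6" "b' < 6" "\<And>k. k < 6 \<Longrightarrow> 3 dvd g k - (hadamard_row b' k - hadamard_row b k)"
  shows "1 \<le> cmod (corner_sum d 30 (\<lambda>k. of_int (g k) / 3))"
proof -
  from hadamard_coeff[OF b(1,2)] obtain l r where lr: "l < 30" "r < 6"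
    "\<forall>k<6. 6 dvd (int r * layer_coeff l k + 2 * (hadamard_row b' k - hadamard_row b k))" by blast
  have dvd: "6 dvd int r * layer_coeff l k + 2 * g k" if "k < 6" for k
  proof -
    have "6 dvd int r * layer_coeff l k + 2 * (hadamard_row b' k - hadamard_row b k)" using lr(3) that by blast
    moreover have "6 dvd 2 * (g k - (hadamard_row b' k - hadamard_row b k))" using b(3)[OF that] by presburger
    ultimately show ?thesis by presburger
  qed
  have "30 \<le> (\<Prod>k<d. orbit_factor g r l k)"
  proof -
    have "(\<Prod>k<d. orbit_factor g r l k) = orbit_factor g r l 0 * (\<Prod>k\<in>{..<d} - {0}. orbit_factor g r l k)"
      using d by (intro prod.remove) auto
    moreover have "1 \<le> (\<Prod>k\<in>{..<d} - {0}. orbit_factor g r l k)"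
      by (rule prod_ge_1) (use dvd in \<open>simp add: orbit_factor_def\<close>)
    ultimately show ?thesis using dvd[of 0] by (simp add: orbit_factor_def)
  qed
  also have "\<dots> \<le> (\<Sum>r<6. \<Sum>l<30. \<Prod>k<d. orbit_factor g r l k)"
    using sum_orbit_factor_ge[of r "{l}"] lr by simp
  finally have "30 \<le> (\<Sum>r<6. \<Sum>l<30. \<Prod>k<d. orbit_factor g r l k)" .
  moreover have "corner_sum d 30 (\<lambda>k. of_int (g k) / 3) =
    of_real ((\<Sum>r<6. \<Sum>l<30. \<Prod>k<d. orbit_factor g r l k) / 6)"
    by (rule corner_sum_30[OF d g])
  ultimately show ?thesis by (simp only: norm_of_real)
qed

text \<open>The constant 240 is 8 * 30, from 2 pi < 8 and coordinates bounded by 30; there are at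
  most 30^d corners.\<close>

lemma corner_sum_continuous:
  assumes d: "7 \<le> d" and \<theta>: "\<And>k. k < d \<Longrightarrow> \<bar>\<theta> k\<bar> \<le> \<delta>"
  shows "cmod (corner_sum d 30 (\<lambda>k. h k + \<theta> k) - corner_sum d 30 h) \<le> 30 ^ d * (240 * real d * \<delta>)"
proof -
  have "cmod ((\<Prod>k<d. ex ((h k + \<theta> k) * of_int (n k))) - (\<Prod>k<d. ex (h k * of_int (n k)))) \<le> 240 * real d * \<delta>"
    if n: "n \<in> corners d 30" for n
  proof -
    have nk: "\<bar>real_of_int (n k)\<bar> \<le> 30" if "k < d" for k
      using PiE_mem[OF subsetD[OF corners_subset n], of k] that by simp
    have "\<bar>\<Sum>k<d. \<theta> k * of_int (n k)\<bar> \<le> (\<Sum>k<d. \<delta> * 30)"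
      by (rule order_trans[OF sum_abs], rule sum_mono)
         (auto simp: abs_mult intro!: mult_mono \<theta> nk order_trans[OF abs_ge_zero \<theta>])
    hence s: "\<bar>\<Sum>k<d. \<theta> k * of_int (n k)\<bar> \<le> 30 * real d * \<delta>" by (simp add: mult_ac)
    have "(\<Prod>k<d. ex ((h k + \<theta> k) * of_int (n k))) =
       (\<Prod>k<d. ex (h k * of_int (n k))) * ex (\<Sum>k<d. \<theta> k * of_int (n k))"
      by (simp add: distrib_right ex_add prod.distrib ex_sum)
    hence "cmod ((\<Prod>k<d. ex ((h k + \<theta> k) * of_int (n k))) - (\<Prod>k<d. ex (h k * of_int (n k)))) =
      cmod (\<Prod>k<d. ex (h k * of_int (n k))) * cmod (ex (\<Sum>k<d. \<theta> k * of_int (n k)) - 1)"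
      unfolding norm_mult[symmetric] by (simp add: algebra_simps)
    also have "\<dots> = cmod (ex (\<Sum>k<d. \<theta> k * of_int (n k)) - 1)" by (simp add: prod_norm[symmetric])
    also have "\<dots> \<le> 2 * pi * \<bar>\<Sum>k<d. \<theta> k * of_int (n k)\<bar>" by (rule norm_ex_minus_1)
    also have "\<dots> \<le> 2 * 4 * (30 * real d * \<delta>)"
      using s pi_less_4 by (intro mult_mono) auto
    finally show ?thesis by simp
  qed
  hence "cmod (corner_sum d 30 (\<lambda>k. h k + \<theta> k) - corner_sum d 30 h) \<le> card (corners d 30) * (240 * real d * \<delta>)"
    unfolding corner_sum_def sum_subtractf[symmetric] by (intro sum_norm_bound)
  also have "\<dots> \<le> 30 ^ d * (240 * real d * \<delta>)"
  proof (rule mult_right_mono)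
    have "card (corners d 30) \<le> card (\<Pi>\<^sub>E k\<in>{..<d}. {0..<30::int})"
      by (rule card_mono[OF _ corners_subset]) (auto intro: finite_PiE)
    also have "\<dots> = 30 ^ d" by (simp add: card_PiE)
    finally have "real (card (corners d 30)) \<le> real (30 ^ d)" by (simp only: of_nat_le_iff)
    thus "real (card (corners d 30)) \<le> 30 ^ d" by simp
    show "0 \<le> 240 * real d * \<delta>" using \<theta>[of 0] d by simp
  qed
  finally show ?thesis .
qed

text \<open>The transform has three factors. That of the unit cube is non-zero as the frequencies
  lie in (-1, 1). That of one period has modulus at least 1 at g / 3 and moves by at most 8 d 30^d /
  N < 1. That of the grid of periods is non-zero since |30 \<theta>_k| N < 1.\<close>

lemma ft_corners_nonzero:
  assumes d: "7 \<le> d" and N: "int (8 * d * 30 ^ d) < N"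
    and g: "\<And>k. \<bar>g k\<bar> \<le> 2" "\<And>k. k \<notin> {1..5} \<Longrightarrow> g k = 0"
    and b: "b < 6" "b' < 6" "\<And>k. k \<in> {1..5} \<Longrightarrow> 3 dvd g k - (hadamard_row b' k - hadamard_row b k)"
    and \<theta>: "\<And>k. k < d \<Longrightarrow> \<bar>\<theta> k\<bar> < 1 / of_int (30 * N)"
  shows "ft d (cubes d (corners d (30 * N))) (\<lambda>k. of_int (g k) / 3 + \<theta> k) \<noteq> 0"
proof -
  let ?\<xi> = "\<lambda>k. of_int (g k) / 3 + \<theta> k"
  have N0: "0 < N" using N by (rule le_less_trans[rotated]) simp
  have "corner_sum d 30 ?\<xi> \<noteq> 0"
  proof
    assume 0: "corner_sum d 30 ?\<xi> = 0"
    have "cmod (corner_sum d 30 ?\<xi> - corner_sum d 30 (\<lambda>k. of_int (g k) / 3))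
        \<le> 30 ^ d * (240 * real d * (1 / of_int (30 * N)))"
      by (rule corner_sum_continuous[OF d], rule less_imp_le, rule \<theta>)
    moreover have "1 \<le> cmod (corner_sum d 30 (\<lambda>k. of_int (g k) / 3))"
    proof (rule corner_sum_30_ge_1[OF d _ b(1,2)])
      show "3 dvd g k - (hadamard_row b' k - hadamard_row b k)" if "k < 6" for k
        using b(3)[of k] g(2)[of k] that by (cases "k = 0") (auto simp: hadamard_row_def)
    qed (rule g(2), simp)
    ultimately have "1 \<le> 30 ^ d * (240 * real d * (1 / of_int (30 * N)))"
      unfolding 0 by simp
    hence "real_of_int N \<le> of_int (int (8 * d * 30 ^ d))"
      using N0 by (simp add: field_simps)
    with N show False by (simp only: of_int_le_iff)
  qed
  moreover have "(\<Prod>k<d. \<Sum>x\<in>{0..<N}. ex (30 * \<theta> k * of_int x)) \<noteq> 0"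
  proof (subst prod_zero_iff; clarsimp)
    fix k assume k: "k < d" "(\<Sum>x = 0..<N. ex (30 * \<theta> k * of_int x)) = 0"
    have "\<bar>30 * \<theta> k\<bar> * of_int N < 1"
      using \<theta>[OF k(1)] N0 by (simp add: abs_mult field_simps)
    from sum_ex_nonzero[OF N0 this] k(2) show False by simp
  qed
  moreover have "corner_sum d (30 * N) ?\<xi> =
      corner_sum d 30 ?\<xi> * (\<Prod>k<d. \<Sum>x\<in>{0..<N}. ex (30 * \<theta> k * of_int x))"
  proof (rule corner_sum_factor[OF d N0])
    fix k
    have "30 * (?\<xi> k - \<theta> k) = of_int (10 * g k)" by simp
    thus "30 * (?\<xi> k - \<theta> k) \<in> \<int>" by (metis Ints_of_int)
  qed
  moreover have "(\<Prod>k<d. unit_ft (?\<xi> k)) \<noteq> 0"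
  proof (subst prod_zero_iff; clarsimp)
    fix k assume k: "k < d" "unit_ft (?\<xi> k) = 0"
    have "1 / real_of_int (30 * N) \<le> 1 / 30" using N0 by (simp add: field_simps)
    hence "\<bar>\<theta> k\<bar> < 1 / 30" using \<theta>[OF k(1)] by linarith
    moreover have "\<bar>real_of_int (g k)\<bar> \<le> 2" using g(1)[of k] by linarith
    ultimately have "\<bar>?\<xi> k\<bar> < 1" by (simp add: abs_if split: if_splits)
    from unit_ft_nonzero[OF this] k(2) show False by simp
  qed
  moreover have "ft d (cubes d (corners d (30 * N))) ?\<xi> =
      (\<Prod>k<d. unit_ft (?\<xi> k)) * corner_sum d (30 * N) ?\<xi>"
    unfolding corner_sum_def
  proof (rule ft_cubes[OF finite_corners])
    show "corners d (30 * N) \<subseteq> (\<Pi>\<^sub>E k\<in>{..<d}. UNIV)"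
      by (rule order_trans[OF corners_subset]) (rule PiE_mono, simp)
  qed
  ultimately show ?thesis by simp
qed

lemma card_corners_ge:
  assumes d: "7 \<le> d" and N: "0 < N"
  shows "of_int (30 * N) ^ d / 6 \<le> real (card (corners d (30 * N)))"
proof -
  have card: "corner_sum d m (\<lambda>_. 0) = of_nat (card (corners d m))" for m
    by (simp add: corner_sum_def)
  have "corner_sum d (30 * N) (\<lambda>_. 0) =
    corner_sum d 30 (\<lambda>_. 0) * (\<Prod>k<d. \<Sum>x\<in>{0..<N}. ex (30 * 0 * of_int x))"
    by (rule corner_sum_factor[OF d N]) simp
  hence "complex_of_real (real (card (corners d (30 * N)))) =
    of_real (real (card (corners d 30)) * of_int N ^ d)"
    unfolding card using N by simp
  hence "real (card (corners d (30 * N))) = real (card (corners d 30)) * of_int N ^ d"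
    by (simp only: of_real_eq_iff)
  moreover have "30 ^ d / 6 * of_int N ^ d \<le> real (card (corners d 30)) * of_int N ^ d"
    using card_corners_30[OF d] N by (intro mult_right_mono) auto
  ultimately show ?thesis by (simp add: power_mult_distrib)
qed

section \<open>Packing in (Z/3)^5 and the density contradiction\<close>

text \<open>The six rows and the residues of g on F have a direct sum in (Z/3)^5, so 6 |F| of its
  243 elements are distinct, and 6 * 41 = 246 is too many.\<close>

lemma hadamard_packing:
  fixes g :: "'a \<Rightarrow> nat \<Rightarrow> int"
  assumes "\<And>x y b b'. x \<in> F \<Longrightarrow> y \<in> F \<Longrightarrow> b < 6 \<Longrightarrow> b' < 6 \<Longrightarrow>
    (\<And>k. k \<in> {1..5} \<Longrightarrow> 3 dvd (g x k - g y k) - (hadamard_row b' k - hadamard_row b k)) \<Longrightarrow> x = y"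
  shows "finite F \<and> card F \<le> 40"
proof -
  define \<Phi> where "\<Phi> = (\<lambda>(x, b). \<lambda>k\<in>{1..5}. (g x k + hadamard_row b k) mod 3)"
  let ?T = "\<Pi>\<^sub>E k\<in>{1..5::nat}. {0..<3::int}"
  have inj: "inj_on \<Phi> (F \<times> {..<6})"
  proof (rule inj_onI)
    fix p q assume pq: "p \<in> F \<times> {..<6}" "q \<in> F \<times> {..<6}" "\<Phi> p = \<Phi> q"
    obtain x b y b' where p: "p = (x, b)" "q = (y, b')" by (cases p, cases q)
    have xy: "x \<in> F" "y \<in> F" "b \<in> {..<6}" "b' \<in> {..<6}" "\<Phi> (x, b) = \<Phi> (y, b')"
      using pq unfolding p by blast+
    have eq: "(g x k + hadamard_row b k) mod 3 = (g y k + hadamard_row b' k) mod 3" if "k \<in> {1..5}" for k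
      using fun_cong[OF xy(5), of k] that by (simp add: \<Phi>_def)
    have b: "b < 6" "b' < 6" using xy(3,4) by simp_all
    have "x = y"
    proof (rule assms[OF xy(1,2) b])
      show "3 dvd (g x k - g y k) - (hadamard_row b' k - hadamard_row b k)" if "k \<in> {1..5}" for k
        using eq[OF that] by presburger
    qed
    moreover have "b = b'"
    proof (rule hadamard_row_inj[OF b])
      fix k :: nat assume "k \<in> {1..5}"
      hence "(g y k + hadamard_row b k) mod 3 = (g y k + hadamard_row b' k) mod 3"
        using eq \<open>x = y\<close> by blast
      from mod_diff_cong[OF this refl, of "g y k"]
      show "hadamard_row b k mod 3 = hadamard_row b' k mod 3" by simp
    qed
    ultimately show "p = q" unfolding p by blast
  qed
  have sub: "\<Phi> ` (F \<times> {..<6}) \<subseteq> ?T"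
    unfolding \<Phi>_def by (auto simp: restrict_PiE_iff)
  have finT: "finite ?T" by (intro finite_PiE) auto
  have "finite (F \<times> {..<6::nat})" by (rule inj_on_finite[OF inj sub finT])
  hence finF: "finite F" by (rule finite_cartesian_productD1) (simp add: lessThan_empty_iff)
  have "card (F \<times> {..<6::nat}) \<le> card ?T" by (rule card_inj_on_le[OF inj sub finT])
  hence "card F * 6 \<le> 243" by (simp add: card_cartesian_product card_PiE)
  thus ?thesis using finF by simp
qed

lemma not_spectral_corners:
  assumes d: "7 \<le> d" and N: "int (8 * d * 30 ^ d) < N"
  shows "\<not> spectral d (cubes d (corners d (30 * N)))"
proof -
  define m where "m = 30 * N"
  define \<delta> where "\<delta> = 1 / real_of_int m"
  have N0: "0 < N" using N by (rule le_less_trans[rotated]) simp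
  hence m0: "0 < m" and \<delta>: "0 < \<delta>" "\<delta> < 1 / 3" by (simp_all add: m_def \<delta>_def field_simps)
  interpret bounded_set d "of_int m" "cubes d (corners d m)"
    by (rule bounded_set_cubes[OF corners_subset m0])
  \<comment> \<open>W consists of 3^5 copies of \<open>cell\<close>, one at each point of (1/3) Z^5
    / Z^5. The intervals are half-open, so two points in the same one differ by strictly less than
    \<delta>, the range in which the transform is known not to vanish.\<close>
  define I where "I k = (if k \<in> {1..5} then (\<Union>j\<in>{0..2::int}. {of_int j / 3..<of_int j / 3 + \<delta>}) else {0..<\<delta>})"
    for k :: nat
  define W where "W = PiE {..<d} I"
  have I_sets: "I k \<in> sets borel" for k by (simp add: I_def)
  have W_sets: "W \<in> sets (Rd_borel d)" unfolding W_def by (rule box_in_sets[OF I_sets])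
  have I_measure: "emeasure lborel (I k) = ennreal (if k \<in> {1..5} then 3 * \<delta> else \<delta>)" for k
  proof (cases "k \<in> {1..5}")
    case True
    have "emeasure lborel (\<Union>j\<in>{0..2::int}. {of_int j / 3..<of_int j / 3 + \<delta>}) =
      (\<Sum>j\<in>{0..2::int}. emeasure lborel {of_int j / 3..<of_int j / 3 + \<delta>})"
    proof (rule sum_emeasure[symmetric])
      have "i = j" if "x \<in> {of_int i / 3..<of_int i / 3 + \<delta>}" "x \<in> {of_int j / 3..<of_int j / 3 + \<delta>}"
        for i j :: int and x
      proof -
        have "real_of_int i - of_int j < 1" "real_of_int j - of_int i < 1" using that \<delta> by auto
        thus ?thesis by linarith
      qed
      thus "disjoint_family_on (\<lambda>j::int. {of_int j / 3..<of_int j / 3 + \<delta>}) {0..2}"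
        unfolding disjoint_family_on_def by blast
    qed auto
    also have "\<dots> = (\<Sum>j\<in>{0..2::int}. ennreal \<delta>)" using \<delta> by (intro sum.cong) auto
    also have "\<dots> = ennreal (3 * \<delta>)" using \<delta> by (simp add: ennreal_mult)
    finally show ?thesis using True by (simp add: I_def)
  next
    case False
    hence "I k = {0..<\<delta>}" unfolding I_def by (rule if_not_P)
    moreover from False have "(if k \<in> {1..5} then 3 * \<delta> else \<delta>) = \<delta>" by (rule if_not_P)
    ultimately show ?thesis using \<delta> by simp
  qed
  have "emeasure (Rd_borel d) W = (\<Prod>k<d. emeasure lborel (I k))"
    unfolding W_def using I_sets by (intro lborel_product.emeasure_PiM) auto
  also have "\<dots> = ennreal (\<Prod>k<d. if k \<in> {1..5} then 3 * \<delta> else \<delta>)"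
    unfolding I_measure using \<delta> by (intro prod_ennreal) auto
  also have "(\<Prod>k<d. if k \<in> {1..5} then 3 * \<delta> else \<delta>) = (\<Prod>k<d. (if k \<in> {1..5} then 3 else 1) * \<delta>)"
    by (intro prod.cong) auto
  also have "\<dots> = 243 * \<delta> ^ d"
  proof -
    have "{..<d} \<inter> {k. Suc 0 \<le> k \<and> k \<le> 5} = {1..5}" using d by auto
    thus ?thesis by (simp add: prod.distrib prod.If_cases)
  qed
  finally have W_measure: "emeasure (Rd_borel d) W = ennreal (243 * \<delta> ^ d)" .
  show ?thesis unfolding m_def[symmetric]
  proof (rule not_spectral[OF W_sets, where \<kappa> = 40])
    show "cell \<subseteq> W" unfolding W_def
    proof (rule PiE_mono)
      have "{of_int 0 / 3..<of_int 0 / 3 + \<delta>} \<subseteq> (\<Union>j\<in>{0..2::int}. {of_int j / 3..<of_int j / 3 + \<delta>})"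
        by (rule UN_upper) simp
      thus "{0..<1 / real_of_int m} \<subseteq> I k" for k
        unfolding I_def \<delta>_def[symmetric] by simp
    qed
    have "of_int m ^ d / 6 \<le> V"
      using card_corners_ge[OF d N0] measure_cubes[OF corners_subset m0] by (simp only: m_def)
    hence "of_int m ^ d / 6 * (243 * \<delta> ^ d) \<le> V * (243 * \<delta> ^ d)"
      using \<delta> by (intro mult_right_mono) auto
    \<comment> \<open>The powers of m cancel, which leaves 40.5 against the 40 points that the
      packing bound allows.\<close>
    moreover have "of_int m ^ d / 6 * (243 * \<delta> ^ d) = 243 / 6"
      using m0 by (simp add: \<delta>_def power_divide)
    ultimately have "40 < V * (243 * \<delta> ^ d)" by linarith
    thus "ennreal (real 40) < ennreal V * emeasure (Rd_borel d) W"
      unfolding W_measure using \<delta> by (simp add: ennreal_mult[symmetric] ennreal_less_iff)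
  next
    fix \<Lambda> u assume \<Lambda>: "\<Lambda> \<subseteq> Rd d"
      and orth: "\<forall>l\<in>\<Lambda>. \<forall>l'\<in>\<Lambda>. l \<noteq> l' \<longrightarrow> ft d (cubes d (corners d m)) (\<lambda>k. l k - l' k) = 0"
    let ?F = "{l \<in> \<Lambda>. shift d u l \<in> W}"
    \<comment> \<open>g / 3 is the base point of the copy of \<open>cell\<close> that contains the
      shifted l. Its values off coordinates 1 to 5 are fixed as 0, also beyond d.\<close>
    define P where "P l g \<longleftrightarrow> (\<forall>k<d. shift d u l k - of_int (g k) / 3 \<in> {0..<\<delta>}) \<and>
      (\<forall>k. g k \<in> {0..2}) \<and> (\<forall>k. k \<notin> {1..5} \<longrightarrow> g k = 0)" for l and g :: "nat \<Rightarrow> int"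
    have ex: "\<exists>g. P l g" if "l \<in> ?F" for l
    proof -
      have "\<exists>j\<in>{0..2::int}. (k \<notin> {1..5} \<longrightarrow> j = 0) \<and> (k < d \<longrightarrow> shift d u l k - of_int j / 3 \<in> {0..<\<delta>})" for k
      proof (cases "k < d")
        case True
        have "shift d u l \<in> PiE {..<d} I" using that unfolding W_def by blast
        from PiE_mem[OF this, of k] have mem: "shift d u l k \<in> I k" using True by (simp only: lessThan_iff)
        show ?thesis
        proof (cases "k \<in> {1..5}")
          case k: True
          hence "I k = (\<Union>j\<in>{0..2::int}. {of_int j / 3..<of_int j / 3 + \<delta>})"
            unfolding I_def by (rule if_P)
          with mem obtain j :: int where j: "j \<in> {0..2}"
            "shift d u l k \<in> {of_int j / 3..<of_int j / 3 + \<delta>}" by blast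
          hence "shift d u l k - of_int j / 3 \<in> {0..<\<delta>}"
            unfolding atLeastLessThan_iff by linarith
          thus ?thesis using j(1) k by blast
        next
          case False
          hence "I k = {0..<\<delta>}" unfolding I_def by (rule if_not_P)
          hence "shift d u l k - of_int 0 / 3 \<in> {0..<\<delta>}" using mem by simp
          moreover have "(0::int) \<in> {0..2}" by simp
          ultimately show ?thesis by blast
        qed
      next
        case False
        have "(0::int) \<in> {0..2}" by simp
        thus ?thesis using False by blast
      qed
      then obtain g where "\<forall>k. g k \<in> {0..2::int} \<and> (k \<notin> {1..5} \<longrightarrow> g k = 0) \<and>
         (k < d \<longrightarrow> shift d u l k - of_int (g k) / 3 \<in> {0..<\<delta>})" by metis
      thus ?thesis unfolding P_def by blast
    qed
    define g where "g l = (SOME g. P l g)" for l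
    have g: "P l (g l)" if "l \<in> ?F" for l unfolding g_def using ex[OF that] by (rule someI_ex)
    show "finite ?F \<and> card ?F \<le> 40"
    proof (rule hadamard_packing[of ?F g], rule ccontr)
      fix l l' b b' assume l: "l \<in> ?F" "l' \<in> ?F" and b: "b < 6" "b' < 6"
        and dvd: "\<And>k. k \<in> {1..5} \<Longrightarrow> 3 dvd (g l k - g l' k) - (hadamard_row b' k - hadamard_row b k)"
        and "l \<noteq> l'"
      \<comment> \<open>The shift u cancels in the difference, and \<theta> is the difference of the
        two positions within their copies of \<open>cell\<close>.\<close>
      define \<theta> where "\<theta> k = (l k - l' k) - of_int (g l k - g l' k) / 3" for k
      have "ft d (cubes d (corners d (30 * N))) (\<lambda>k. of_int (g l k - g l' k) / 3 + \<theta> k) \<noteq> 0"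
      proof (rule ft_corners_nonzero[OF d N _ _ b dvd])
        show "\<bar>g l k - g l' k\<bar> \<le> 2" for k
        proof -
          have "g l k \<in> {0..2}" "g l' k \<in> {0..2}" using g[OF l(1)] g[OF l(2)] unfolding P_def by blast+
          thus ?thesis by auto
        qed
        show "g l k - g l' k = 0" if "k \<notin> {1..5}" for k
          using g[OF l(1)] g[OF l(2)] that unfolding P_def by simp
        show "\<bar>\<theta> k\<bar> < 1 / of_int (30 * N)" if k: "k < d" for k
        proof -
          have "shift d u l k - of_int (g l k) / 3 \<in> {0..<\<delta>}" "shift d u l' k - of_int (g l' k) / 3 \<in> {0..<\<delta>}"
            using g[OF l(1)] g[OF l(2)] k unfolding P_def by blast+
          hence "\<bar>\<theta> k\<bar> < \<delta>" using k by (auto simp: \<theta>_def abs_less_iff diff_divide_distrib)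
          thus ?thesis by (simp only: \<delta>_def m_def)
        qed
      qed
      moreover have "(\<lambda>k. of_int (g l k - g l' k) / 3 + \<theta> k) = (\<lambda>k. l k - l' k)" by (simp add: \<theta>_def)
      ultimately show False using orth l \<open>l \<noteq> l'\<close> by (simp add: m_def)
    qed
  qed
qed

theorem theorem1p5:
  "\<exists>d\<^sub>0::nat. \<forall>d\<ge>d\<^sub>0. \<exists>\<Omega>::(nat \<Rightarrow> real) set.
     openin (Rd_top d) \<Omega> \<and>
     emeasure (Rd_lebesgue d) \<Omega> < \<infinity> \<and>
     connectedin (Rd_top d) \<Omega> \<and>
     tiles_by_translations d \<Omega> \<and>
     \<not> spectral d \<Omega>"
proof (intro exI[of _ 7] allI impI)
  \<comment> \<open>Six coordinates carry the forms and a seventh the layers; any further ones are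
    unconstrained within the box, so every larger d is covered by the same construction.\<close>
  fix d :: nat assume d: "7 \<le> d"
  define N where "N = int (8 * d * 30 ^ d) + 1"
  define \<Omega> where "\<Omega> = cubes d (corners d (30 * N))"
  have "0 < N" unfolding N_def by (rule add_nonneg_pos) auto
  hence m: "30 dvd 30 * N" "0 < 30 * N" by auto
  have sub: "corners d (30 * N) \<subseteq> (\<Pi>\<^sub>E k\<in>{..<d}. UNIV)"
    by (rule order_trans[OF corners_subset]) (rule PiE_mono, simp)
  have "corners d (30 * N) \<noteq> {}"
  proof -
    have "form l (\<lambda>k\<in>{..<d}. 0) = 0" for l
      using d by (simp add: form_def)
    hence "(\<lambda>k\<in>{..<d}. 0) \<in> corners d (30 * N)" using m(2) by (simp add: corners_def)
    thus ?thesis by blast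
  qed
  moreover have "{\<lambda>k\<in>{..<d}. tile_vector i k + 30 * N * z k | i z. 0 \<le> i \<and> i < 6} \<subseteq> (\<Pi>\<^sub>E k\<in>{..<d}. UNIV)"
  proof clarify
    show "(\<lambda>k\<in>{..<d}. tile_vector i k + 30 * N * z k) \<in> (\<Pi>\<^sub>E k\<in>{..<d}. UNIV)" for i and z :: "nat \<Rightarrow> int"
      unfolding restrict_PiE_iff by simp
  qed
  ultimately have tiles: "tiles_by_translations d \<Omega>" unfolding \<Omega>_def
    by (rule tiles_cubes[OF corners_subset m(2) _ _ corners_tile[OF d m]])
  have "connectedin (Rd_top d) \<Omega>" unfolding \<Omega>_def
    by (rule connectedin_cubes[OF sub corners_connected[OF d m(1)]])
  moreover have "\<not> spectral d \<Omega>" unfolding \<Omega>_def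
    by (rule not_spectral_corners[OF d]) (simp add: N_def)
  moreover have "emeasure (Rd_lebesgue d) \<Omega> < \<infinity>"
    using tiles unfolding tiles_by_translations_def positive_finite_measure_set_def by blast
  ultimately show "\<exists>\<Omega>. openin (Rd_top d) \<Omega> \<and> emeasure (Rd_lebesgue d) \<Omega> < \<infinity> \<and>
     connectedin (Rd_top d) \<Omega> \<and> tiles_by_translations d \<Omega> \<and> \<not> spectral d \<Omega>"
    using tiles openin_cubes unfolding \<Omega>_def by blast
qed

end
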